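(* Let $G$ be a bipartite graph on vertex set $X\sqcup Y$, and let $H_G$ be the unique (up to isomorphism) horizontal bipartite graph with the same row sizes as $G$, i.e. $\deg_{H_G}(x)=\deg_G(x)$ for all $x\in X$. Then for all $i$ and all $X'\subseteq X$, $$\beta_{i,X',\bullet}(I(G))\le\beta_{i,X',\bullet}(I(H_G))=\binom{|\deg(X')|}{i+1},$$ where $|\deg(X')|:=\sum_{x\in X'}\deg_G(x)$. Furthermore, equality occurs in the inequality for all $i$ and all $X'\subseteq X$ if and only if $G$ is horizontal-vertical.
   Context: All graphs are finite and simple. A bipartite graph $G$ on $X\sqcup Y$ (all edges join $X$ to $Y$) has diagram $\{(x,y):\{x,y\}\in E(G)\}\subseteq X\times Y$, whose elements are called cells; the row of $x\in X$ is $R_x=\{y:\{x,y\}\in E(G)\}$ and the column of $y\in Y$ is $\{x:\{x,y\}\in E(G)\}$. $G$ is horizontal if every cell of its diagram is alone within its column. $G$ is horizontal-vertical if every cell of its diagram is alone within its column or alone within its row (or both). The graph $H_G$ has vertex set $X\sqcup Y''$ for some finite set $Y''$. Let $k$ be a field. $I(G)\subset k[X\sqcup Y]$ is the edge ideal, generated by the monomials $xy$ for edges $\{x,y\}$ of $G$. For $X'\subseteq X$, $Y'\subseteq Y$, $\beta_{i,X'\sqcup Y'}(I(G))=\dim_k\mathrm{Tor}_i^{k[X\sqcup Y]}(I(G),k)_{X'\sqcup Y'}$ is the finely graded Betti number in the multidegree given by the indicator vector of $X'\sqcup Y'$, and $\beta_{i,X',\bullet}(I(G))=\sum_{Y'\subseteq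 Y}\beta_{i,X'\sqcup Y'}(I(G))$; likewise for $H_G$.
   Formalization: The printed formula β_{i,X',•}(I(H_G)) = binom(|deg(X')|, i+1) fails for two disjoint edges, X' = {x1,x2}, i = 0 (0 versus 2); it is replaced by the sum over all A ⊆ X' of β_{i,A,•}(I(H_G)) = binom(|deg(X')|, i+1). *)

theory Defs
  imports Complex_Main "HOL-Library.Poly_Mapping" "HOL-Library.Function_Algebras"
begin

section \<open>Bipartite graphs\<close>

text \<open>
  The vertex set \<open>X \<squnion> Y\<close> is the disjoint sum \<open>X <+> Y\<close>, so a vertex is \<open>Inl x\<close> or \<open>Inr y\<close>, and an
  edge is a two-element set of vertices.
\<close>

definition bipartite_graph :: "'x set \<Rightarrow> 'y set \<Rightarrow> ('x + 'y) set set \<Rightarrow> bool" where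
  "bipartite_graph X Y E \<longleftrightarrow>
     finite X \<and> finite Y \<and> (\<forall>e\<in>E. \<exists>x\<in>X. \<exists>y\<in>Y. e = {Inl x, Inr y})"

definition degree :: "'v set set \<Rightarrow> 'v \<Rightarrow> nat" where
  "degree E v = card {e \<in> E. v \<in> e}"

definition diagram :: "('x + 'y) set set \<Rightarrow> ('x \<times> 'y) set" where
  "diagram E = {(x, y). {Inl x, Inr y} \<in> E}"

definition row :: "('x + 'y) set set \<Rightarrow> 'x \<Rightarrow> 'y set" where
  "row E x = {y. {Inl x, Inr y} \<in> E}"

definition column :: "('x + 'y) set set \<Rightarrow> 'y \<Rightarrow> 'x set" where
  "column E y = {x. {Inl x, Inr y} \<in> E}"

definition horizontal :: "('x + 'y) set set \<Rightarrow> bool" where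
  "horizontal E \<longleftrightarrow> (\<forall>(x, y) \<in> diagram E. column E y = {x})"

definition horizontal_vertical :: "('x + 'y) set set \<Rightarrow> bool" where
  "horizontal_vertical E \<longleftrightarrow> (\<forall>(x, y) \<in> diagram E. column E y = {x} \<or> row E x = {y})"

lemma horizontal_graph_exists:
  fixes X :: "'x set" and Y :: "'y set"
  assumes "bipartite_graph X Y E"
  shows "\<exists>(Y'' :: ('x \<times> 'y) set) E''. bipartite_graph X Y'' E'' \<and> horizontal E'' \<and>
           (\<forall>x\<in>X. degree E'' (Inl x) = degree E (Inl x))"
proof -
  define Y'' where "Y'' = diagram E"
  define E'' :: "('x + 'x \<times> 'y) set set" where "E'' = (\<lambda>c. {Inl (fst c), Inr c}) ` diagram E"
  have sub: "diagram E \<subseteq> X \<times> Y"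
  proof (clarsimp simp: diagram_def)
    fix x y assume "{Inl x, Inr y} \<in> E"
    then obtain x' y' where "x' \<in> X" "y' \<in> Y" "{Inl x, Inr y} = {Inl x', Inr y'}"
      using assms unfolding bipartite_graph_def by meson
    then show "x \<in> X \<and> y \<in> Y" by (auto simp: doubleton_eq_iff)
  qed
  have fin: "finite (diagram E)"
    using sub assms by (auto simp: bipartite_graph_def intro: finite_subset)
  have bip: "bipartite_graph X Y'' E''"
    using sub fin assms by (fastforce simp: bipartite_graph_def Y''_def E''_def)
  have hor: "horizontal E''"
    by (auto simp: horizontal_def diagram_def column_def E''_def doubleton_eq_iff)
  have "degree E'' (Inl x) = degree E (Inl x)" if "x \<in> X" for x
  proof -
    have 1: "{e \<in> E''. Inl x \<in> e} = (\<lambda>y. {Inl x, Inr (x, y)}) ` row E x"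
      by (force simp: E''_def diagram_def row_def image_iff)
    have 2: "{e \<in> E. Inl x \<in> e} = (\<lambda>y. {Inl x, Inr y}) ` row E x"
    proof (intro equalityI subsetI)
      fix e assume e: "e \<in> {e \<in> E. Inl x \<in> e}"
      then obtain x' y' where "e = {Inl x', Inr y'}"
        using assms unfolding bipartite_graph_def by blast
      then show "e \<in> (\<lambda>y. {Inl x, Inr y}) ` row E x" using e by (auto simp: row_def)
    qed (auto simp: row_def)
    show ?thesis unfolding degree_def 1 2
      by (subst (1 2) card_image) (auto simp: inj_on_def doubleton_eq_iff)
  qed
  with bip hor show ?thesis by blast
qed

section \<open>Polynomial rings and edge ideals\<close>

text \<open>
  A monomial is its exponent vector, a finitely supported function from the variables to \<open>nat\<close>; a
  polynomial is a finitely supported function from monomials to the field, and multiplication is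
  the convolution product of \<^theory>\<open>HOL-Library.Poly_Mapping\<close>.
\<close>

type_synonym 'v monom = "'v \<Rightarrow>\<^sub>0 nat"
type_synonym ('v, 'k) mpoly = "'v monom \<Rightarrow>\<^sub>0 'k"

definition polynomials :: "'v set \<Rightarrow> ('v, 'k::field) mpoly set" where
  "polynomials V = {p. \<forall>m \<in> Poly_Mapping.keys p. Poly_Mapping.keys m \<subseteq> V}"

definition var :: "'v \<Rightarrow> ('v, 'k::field) mpoly" where
  "var v = Poly_Mapping.single (Poly_Mapping.single v 1) 1"

text \<open>The ideal of \<open>k[V]\<close> generated by the products \<open>\<Prod>v\<in>e. var v\<close> over the edges \<open>e\<close>.\<close>

definition edge_ideal :: "'v set \<Rightarrow> 'v set set \<Rightarrow> ('v, 'k::field) mpoly set" where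
  "edge_ideal V E = {\<Sum>e\<in>E. q e * (\<Prod>v\<in>e. var v) | q. \<forall>e\<in>E. q e \<in> polynomials V}"

definition indicator_degree :: "'v set \<Rightarrow> 'v monom" where
  "indicator_degree W = (\<Sum>v\<in>W. Poly_Mapping.single v 1)"

section \<open>Tor and finely graded Betti numbers\<close>

text \<open>
  A (not necessarily minimal) augmented complex \<open>\<dots> \<rightarrow> F 1 \<rightarrow> F 0 \<rightarrow> I\<close> of finitely generated
  multigraded free modules over \<open>S = k[V]\<close>.  The module \<open>F i\<close> has the basis elements
  \<open>0, \<dots>, fc_rank i - 1\<close>, the \<open>j\<close>-th of multidegree \<open>fc_shift i j\<close>.  The map \<open>F 0 \<rightarrow> I\<close> sends the
  \<open>j\<close>-th basis element to \<open>fc_aug j\<close>, and \<open>F (Suc i) \<rightarrow> F i\<close> sends the \<open>j\<close>-th basis element to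
  the vector with \<open>l\<close>-th coordinate \<open>fc_diff i j l\<close>.
\<close>

record (overloaded) ('v, 'k) free_complex =
  fc_rank :: "nat \<Rightarrow> nat"
  fc_shift :: "nat \<Rightarrow> nat \<Rightarrow> 'v monom"
  fc_aug :: "nat \<Rightarrow> ('v, 'k) mpoly"
  fc_diff :: "nat \<Rightarrow> nat \<Rightarrow> nat \<Rightarrow> ('v, 'k) mpoly"

definition fc_module ::
    "'v set \<Rightarrow> ('v, 'k::field) free_complex \<Rightarrow> nat \<Rightarrow> (nat \<Rightarrow> ('v, 'k) mpoly) set" where
  "fc_module V F i = {f. \<forall>j. f j \<in> polynomials V \<and> (j \<ge> fc_rank F i \<longrightarrow> f j = 0)}"

definition aug_map ::
    "('v, 'k::field) free_complex \<Rightarrow> (nat \<Rightarrow> ('v, 'k) mpoly) \<Rightarrow> ('v, 'k) mpoly" where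
  "aug_map F f = (\<Sum>j<fc_rank F 0. f j * fc_aug F j)"

definition diff_map ::
    "('v, 'k::field) free_complex \<Rightarrow> nat \<Rightarrow> (nat \<Rightarrow> ('v, 'k) mpoly) \<Rightarrow> (nat \<Rightarrow> ('v, 'k) mpoly)" where
  "diff_map F i f =
     (\<lambda>l. if l < fc_rank F i then \<Sum>j<fc_rank F (Suc i). f j * fc_diff F i j l else 0)"

text \<open>
  The two clauses with \<open>Poly_Mapping.keys\<close> on the left say that the maps preserve multidegrees: a
  monomial \<open>m\<close> in the coefficient of a basis element of degree \<open>\<beta>\<close> contributes degree \<open>m + \<beta>\<close>.
\<close>

definition graded_free_resolution ::
    "'v set \<Rightarrow> ('v, 'k::field) mpoly set \<Rightarrow> ('v, 'k) free_complex \<Rightarrow> bool" where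
  "graded_free_resolution V I F \<longleftrightarrow>
     (\<forall>i. \<forall>j<fc_rank F i. Poly_Mapping.keys (fc_shift F i j) \<subseteq> V) \<and>
     (\<forall>j<fc_rank F 0. fc_aug F j \<in> polynomials V \<and>
        (\<forall>m \<in> Poly_Mapping.keys (fc_aug F j). m = fc_shift F 0 j)) \<and>
     (\<forall>i. \<forall>j<fc_rank F (Suc i). \<forall>l<fc_rank F i. fc_diff F i j l \<in> polynomials V \<and>
        (\<forall>m \<in> Poly_Mapping.keys (fc_diff F i j l). m + fc_shift F i l = fc_shift F (Suc i) j)) \<and>
     aug_map F ` fc_module V F 0 = I \<and>
     {f \<in> fc_module V F 0. aug_map F f = 0} = diff_map F 0 ` fc_module V F 1 \<and>
     (\<forall>i. {f \<in> fc_module V F (Suc i). diff_map F i f = 0} =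
        diff_map F (Suc i) ` fc_module V F (Suc (Suc i)))"

text \<open>
  The complex of \<open>k\<close>-vector spaces \<open>F \<otimes> k\<close>, where \<open>k = S / (var v | v \<in> V)\<close>, in multidegree \<open>\<alpha>\<close>: the
  base change of a free module has the same basis, and that of a matrix over \<open>S\<close> is the matrix of
  the constant coefficients.
\<close>

definition tor_chains ::
    "('v, 'k::field) free_complex \<Rightarrow> nat \<Rightarrow> 'v monom \<Rightarrow> (nat \<Rightarrow> 'k) set" where
  "tor_chains F i \<alpha> = {c. \<forall>j. c j \<noteq> 0 \<longrightarrow> j < fc_rank F i \<and> fc_shift F i j = \<alpha>}"

definition tor_map :: "('v, 'k::field) free_complex \<Rightarrow> nat \<Rightarrow> (nat \<Rightarrow> 'k) \<Rightarrow> (nat \<Rightarrow> 'k)" where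
  "tor_map F i c = (\<lambda>l. if l < fc_rank F i
     then \<Sum>j<fc_rank F (Suc i). c j * Poly_Mapping.lookup (fc_diff F i j l) 0 else 0)"

definition tor_cycles ::
    "('v, 'k::field) free_complex \<Rightarrow> nat \<Rightarrow> 'v monom \<Rightarrow> (nat \<Rightarrow> 'k) set" where
  "tor_cycles F i \<alpha> =
     {c \<in> tor_chains F i \<alpha>. case i of 0 \<Rightarrow> True | Suc h \<Rightarrow> tor_map F h c = 0}"

definition tor_boundaries ::
    "('v, 'k::field) free_complex \<Rightarrow> nat \<Rightarrow> 'v monom \<Rightarrow> (nat \<Rightarrow> 'k) set" where
  "tor_boundaries F i \<alpha> = tor_map F i ` tor_chains F (Suc i) \<alpha>"

definition vec_dim :: "(nat \<Rightarrow> 'k::field) set \<Rightarrow> nat" where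
  "vec_dim = vector_space.dim (\<lambda>a c j. a * c j)"

text \<open>
  The dimension of the degree \<open>\<alpha>\<close> part of \<open>Tor i (I, k)\<close>, computed from a multigraded free
  resolution of \<open>I\<close>.  Up to isomorphism the homology does not depend on the resolution, and for
  finite \<open>V\<close> every multigraded ideal has a resolution by finitely generated modules.  Boundaries
  are cycles and all spaces are finite-dimensional, so the difference is the dimension of the quotient.
\<close>

definition betti :: "'v set \<Rightarrow> ('v, 'k::field) mpoly set \<Rightarrow> nat \<Rightarrow> 'v monom \<Rightarrow> nat" where
  "betti V I i \<alpha> = (let F = (SOME F. graded_free_resolution V I F)
     in vec_dim (tor_cycles F i \<alpha>) - vec_dim (tor_boundaries F i \<alpha>))"

definition row_betti ::
    "'k::field itself \<Rightarrow> 'x set \<Rightarrow> 'y set \<Rightarrow> ('x + 'y) set set \<Rightarrow> nat \<Rightarrow> 'x set \<Rightarrow> nat" where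
  "row_betti k X Y E i X' =
     (\<Sum>Y'\<in>Pow Y. betti (X <+> Y) (edge_ideal (X <+> Y) E :: ('x + 'y, 'k) mpoly set) i
        (indicator_degree (X' <+> Y')))"

end

theory Submission
  imports Defs
begin

text \<open>
  The edge ideal of any graph has the Taylor resolution: it is free on the nonempty sets \<open>\<sigma>\<close> of
  edges, with \<open>\<sigma>\<close> in homological degree \<open>card \<sigma> - 1\<close> and in the multidegree of the vertex set
  \<open>\<Union>\<sigma>\<close>, and its differential is the boundary of the full simplex on the edges, made homogeneous by
  monomial coefficients.  After tensoring with \<open>k\<close>, the multidegree \<open>W\<close> retains the sets \<open>\<sigma>\<close> with
  \<open>\<Union>\<sigma> = W\<close>, so \<open>\<beta>\<^sub>i\<^sub>,\<^sub>W\<close> is at most the number of such \<open>\<sigma>\<close> with \<open>i + 1\<close> elements, with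
  equality for all \<open>i\<close> and \<open>W\<close> exactly when the tensored differential vanishes.  This differential
  sends \<open>\<sigma>\<close> to the signed sum of the \<open>\<sigma> - {e}\<close> with \<open>\<Union>(\<sigma> - {e}) = \<Union>\<sigma>\<close>.  It vanishes for all
  \<open>\<sigma>\<close> if every edge \<open>e\<close> has a vertex that lies on no other edge, that is, if \<open>G\<close> is
  horizontal-vertical; and if some edge has no such vertex, then it is nonzero on the set of all
  edges.

  Summing over the subsets of \<open>Y\<close> forgets the columns.  So \<open>\<beta>\<^sub>i\<^sub>,\<^sub>X\<^sub>'\<close> of \<open>G\<close> is at most the number
  of sets of \<open>i + 1\<close> edges that meet exactly the rows in \<open>X'\<close> (\<open>row_betti_le\<close>), with equality for
  horizontal-vertical graphs (\<open>row_betti_eq\<close>), in particular for \<open>H\<close>, and with a strict inequality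
  somewhere for all other graphs (\<open>row_betti_less\<close>).  The number of these sets depends only on the
  row sizes, which \<open>G\<close> and \<open>H\<close> share (\<open>card_row_edge_sets_cong\<close>).  Without the condition that every
  row of \<open>X'\<close> is met, the sets are the \<open>(i + 1)\<close>-subsets of all edges in the rows of \<open>X'\<close>, which
  gives the binomial coefficient (\<open>sum_row_edge_sets\<close>).

  Betti numbers are defined from an unspecified resolution, so the argument needs that the Taylor
  complex is a resolution (\<open>taylor_resolution\<close>) and that all resolutions give the same numbers
  (\<open>betti_eq\<close>).  Both are statements about multigraded modules, and in a single multidegree such a
  module is a finite-dimensional vector space: a homogeneous element is a vector of scalars, and a
  homogeneous matrix is a matrix of scalars.  Under this translation Taylor exactness is the
  contractibility of a simplex, and independence of the resolution is the comparison of two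
  resolutions by chain maps that are inverse up to homotopy.
\<close>

section \<open>Dimensions of subquotients\<close>

lemma (in vector_space) card_independent_le_dim:
  assumes T: "finite T" "V \<subseteq> span T" and B: "independent B" "B \<subseteq> V"
  shows "card B \<le> dim V"
proof -
  obtain C where C: "B \<subseteq> C" "C \<subseteq> V" "independent C" "V \<subseteq> span C"
    using maximal_independent_subset_extend[OF B(2,1)] .
  have "finite C"
    using independent_span_bound[OF T(1) C(3)] C(2) T(2) by blast
  then show ?thesis
    using C basis_card_eq_dim[of C V] card_mono[of C B] by simp
qed

lemma (in vector_space) dim_less_proper_subspace:
  assumes T: "finite T" "V \<subseteq> span T" and W: "subspace W" "W \<subseteq> V" and v: "v \<in> V" "v \<notin> W"
  shows "dim W < dim V"
proof -
  obtain B where B: "B \<subseteq> W" "independent B" "W \<subseteq> span B" "card B = dim W"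
    using basis_exists[of W] by blast
  have "finite B"
    using independent_span_bound[OF T(1) B(2)] B(1) W(2) T(2) by blast
  have "v \<notin> span B"
    using v(2) span_minimal[OF B(1) W(1)] by blast
  then have ind: "independent (insert v B)" and "v \<notin> B"
    using independent_insertI[OF _ B(2)] span_base by auto
  then have "card (insert v B) \<le> dim V"
    using card_independent_le_dim[OF T ind] B(1) W(2) v(1) by blast
  then show ?thesis using \<open>finite B\<close> \<open>v \<notin> B\<close> B(4) by simp
qed

text \<open>
  A linear map that takes \<open>Z\<close> into \<open>Z'\<close> and pulls \<open>B'\<close> back into \<open>B\<close> induces an injection of
  \<open>Z / B\<close> into a subspace of \<open>Z'\<close> that meets \<open>B'\<close> trivially: vectors completing a basis of \<open>B\<close>
  to one of \<open>Z\<close> have images that are independent modulo \<open>B'\<close>.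
\<close>

lemma (in vector_space_pair) dim_subquotient_le:
  assumes f: "Vector_Spaces.linear s1 s2 f"
    and fin: "finite T" "Z \<subseteq> vs1.span T" "finite T'" "Z' \<subseteq> vs2.span T'"
    and sub: "vs1.subspace Z" and B: "vs1.subspace B" "B \<subseteq> Z" and B': "vs2.subspace B'" "B' \<subseteq> Z'"
    and Z: "\<And>c. c \<in> Z \<Longrightarrow> f c \<in> Z'" and pull: "\<And>c. c \<in> Z \<Longrightarrow> f c \<in> B' \<Longrightarrow> c \<in> B"
  shows "vs1.dim Z - vs1.dim B \<le> vs2.dim Z' - vs2.dim B'"
proof -
  obtain bB where bB: "bB \<subseteq> B" "vs1.independent bB" "B \<subseteq> vs1.span bB" "card bB = vs1.dim B"
    using vs1.basis_exists[of B] by blast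
  obtain bZ where bZ: "bB \<subseteq> bZ" "bZ \<subseteq> Z" "vs1.independent bZ" "Z \<subseteq> vs1.span bZ"
    using vs1.maximal_independent_subset_extend[of bB Z] bB B(2) by blast
  obtain bB' where bB': "bB' \<subseteq> B'" "vs2.independent bB'" "B' \<subseteq> vs2.span bB'" "card bB' = vs2.dim B'"
    using vs2.basis_exists[of B'] by blast
  have finZ: "finite bZ"
    using vs1.independent_span_bound[OF fin(1) bZ(3)] bZ(2) fin(2) by blast
  have finB': "finite bB'"
    using vs2.independent_span_bound[OF fin(3) bB'(2)] bB'(1) B'(2) fin(4) by blast
  have spB': "vs2.span bB' \<subseteq> B'"
    using bB'(1) B'(1) by (rule vs2.span_minimal)
  have key: "vs2.independent (bB' \<union> f ` R) \<and> card (bB' \<union> f ` R) = card bB' + card R"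
    if "finite R" "R \<subseteq> bZ - bB" for R
    using that
  proof (induction R rule: finite_induct)
    case empty
    then show ?case using bB' by simp
  next
    case (insert r R)
    have notin: "f r \<notin> vs2.span (bB' \<union> f ` R)"
    proof
      assume "f r \<in> vs2.span (bB' \<union> f ` R)"
      then obtain b z where bz: "b \<in> vs2.span bB'" "z \<in> vs2.span (f ` R)" "f r = b + z"
        by (auto simp: vs2.span_Un)
      then obtain w where w: "w \<in> vs1.span R" "z = f w"
        using linear_span_image[OF f] by blast
      have "f (r - w) = b"
        using bz(3) w(2) by (simp add: linear_diff[OF f])
      moreover have "r - w \<in> Z"
        using insert.prems bZ(2) w(1) vs1.span_minimal[OF _ sub, of R]
        by (intro vs1.subspace_diff[OF sub]) auto
      ultimately have "r - w \<in> B"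
        using pull bz(1) spB' by blast
      then have "r - w \<in> vs1.span (bZ - {r})"
        using bB(3) vs1.span_mono[of bB "bZ - {r}"] insert.prems bZ(1) by blast
      moreover have "w \<in> vs1.span (bZ - {r})"
        using w(1) vs1.span_mono[of R "bZ - {r}"] insert by blast
      ultimately have "r \<in> vs1.span (bZ - {r})"
        using vs1.span_add[of "r - w" _ w] by simp
      moreover have "r \<in> bZ" using insert.prems by blast
      ultimately show False
        using bZ(3) unfolding vs1.dependent_def by blast
    qed
    have "f r \<notin> bB' \<union> f ` R"
      using notin vs2.span_base[of "f r" "bB' \<union> f ` R"] by argo
    then show ?case
      using insert finB' vs2.independent_insertI[OF notin] by simp
  qed
  have "card bZ = vs1.dim Z"
    using vs1.basis_card_eq_dim bZ by blast
  then have card: "card (bZ - bB) = vs1.dim Z - vs1.dim B"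
    using bZ(1) finZ bB(4) finite_subset by (subst card_Diff_subset) auto
  have "bB' \<union> f ` (bZ - bB) \<subseteq> Z'"
    using bB'(1) B'(2) bZ(2) Z by blast
  then have "card (bB' \<union> f ` (bZ - bB)) \<le> vs2.dim Z'"
    using vs2.card_independent_le_dim[OF fin(3,4)] key[of "bZ - bB"] finZ by blast
  then show ?thesis
    using key[of "bZ - bB"] finZ card bB'(4) by simp
qed

interpretation coords: vector_space "\<lambda>a (c :: nat \<Rightarrow> 'k::field) j. a * c j"
  by unfold_locales (auto simp: fun_eq_iff algebra_simps)

interpretation coords_pair: vector_space_pair
  "\<lambda>a (c :: nat \<Rightarrow> 'k::field) j. a * c j" "\<lambda>a (c :: nat \<Rightarrow> 'k::field) j. a * c j"
  by unfold_locales

lemma vec_dim_eq: "vec_dim = coords.dim"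
  by (simp add: vec_dim_def)

definition unit_vec :: "nat \<Rightarrow> nat \<Rightarrow> 'k::field" where
  "unit_vec j = (\<lambda>l. if l = j then 1 else 0)"

lemma supported_in_span:
  assumes "finite S"
  shows "{c :: nat \<Rightarrow> 'k::field. \<forall>j. c j \<noteq> 0 \<longrightarrow> j \<in> S} \<subseteq> coords.span (unit_vec ` S)"
proof
  fix c :: "nat \<Rightarrow> 'k" assume c: "c \<in> {c. \<forall>j. c j \<noteq> 0 \<longrightarrow> j \<in> S}"
  have sum_apply: "(\<Sum>j\<in>A. g j) l = (\<Sum>j\<in>A. g j l)" for A :: "nat set" and g :: "nat \<Rightarrow> nat \<Rightarrow> 'k" and l
    by (induction A rule: infinite_finite_induct) auto
  have "c = (\<Sum>j\<in>S. (\<lambda>l. c j * unit_vec j l))"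
  proof
    fix l
    show "c l = (\<Sum>j\<in>S. (\<lambda>l. c j * unit_vec j l)) l"
      using c assms by (auto simp: sum_apply unit_vec_def if_distrib cong: if_cong)
  qed
  also have "\<dots> \<in> coords.span (unit_vec ` S)"
    by (intro coords.span_sum coords.span_scale coords.span_base) auto
  finally show "c \<in> coords.span (unit_vec ` S)" .
qed

lemma dim_supported:
  assumes "finite S"
  shows "coords.dim {c :: nat \<Rightarrow> 'k::field. \<forall>j. c j \<noteq> 0 \<longrightarrow> j \<in> S} = card S"
proof (rule coords.dim_unique[of "unit_vec ` S"])
  have inj: "inj_on (unit_vec :: nat \<Rightarrow> nat \<Rightarrow> 'k) S"
    by (auto simp: inj_on_def unit_vec_def fun_eq_iff split: if_splits)
  then show "card (unit_vec ` S :: (nat \<Rightarrow> 'k) set) = card S"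
    by (rule card_image)
  show "unit_vec ` S \<subseteq> {c :: nat \<Rightarrow> 'k. \<forall>j. c j \<noteq> 0 \<longrightarrow> j \<in> S}"
    by (auto simp: unit_vec_def split: if_splits)
  show "{c :: nat \<Rightarrow> 'k. \<forall>j. c j \<noteq> 0 \<longrightarrow> j \<in> S} \<subseteq> coords.span (unit_vec ` S)"
    by (rule supported_in_span[OF assms])
  show "coords.independent (unit_vec ` S :: (nat \<Rightarrow> 'k) set)"
    unfolding coords.dependent_def
  proof clarsimp
    fix j :: nat
    assume "j \<in> S" and *: "(unit_vec j :: nat \<Rightarrow> 'k) \<in> coords.span (unit_vec ` S - {unit_vec j})"
    have "coords.subspace {c :: nat \<Rightarrow> 'k. c j = 0}"
      by (auto simp: coords.subspace_def)
    moreover have "unit_vec ` S - {unit_vec j} \<subseteq> {c :: nat \<Rightarrow> 'k. c j = 0}"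
      by (auto simp: unit_vec_def fun_eq_iff)
    ultimately have "(unit_vec j :: nat \<Rightarrow> 'k) \<in> {c. c j = 0}"
      using * coords.span_minimal by blast
    then show False by (simp add: unit_vec_def)
  qed
qed

section \<open>Comparison of graded complexes of scalar matrices\<close>

text \<open>
  Matrices act on row vectors: \<open>M j\<close> is the image of the \<open>j\<close>-th basis element.  The entries are
  scalars in the graded complexes below and polynomials in the resolutions that they come from.
\<close>

definition lin :: "nat \<Rightarrow> (nat \<Rightarrow> nat \<Rightarrow> 'a) \<Rightarrow> (nat \<Rightarrow> 'a) \<Rightarrow> nat \<Rightarrow> 'a::comm_ring_1" where
  "lin n M c = (\<lambda>l. \<Sum>j<n. c j * M j l)"

lemma lin_add: "lin n M (\<lambda>j. c j + d j) = (\<lambda>l. lin n M c l + lin n M d l)"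
  by (simp add: lin_def distrib_right sum.distrib)

lemma lin_diff: "lin n M (\<lambda>j. c j - d j) = (\<lambda>l. lin n M c l - lin n M d l)"
  by (simp add: lin_def left_diff_distrib sum_subtractf)

lemma lin_scale: "lin n M (\<lambda>j. a * c j) = (\<lambda>l. a * lin n M c l)"
  by (simp add: lin_def sum_distrib_left mult.assoc)

lemma lin_zero [simp]: "lin n M (\<lambda>_. 0) = (\<lambda>_. 0)" "lin n M 0 = 0"
  by (simp_all add: lin_def fun_eq_iff)

lemma lin_comp: "lin n M (lin m N c) = lin m (\<lambda>j. lin n M (N j)) c"
  by (auto simp: lin_def fun_eq_iff sum_distrib_left sum_distrib_right mult.assoc intro: sum.swap)

lemma lin_cong: "(\<And>j. j < n \<Longrightarrow> M j = N j) \<Longrightarrow> lin n M c = lin n N c"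
  by (simp add: lin_def)

lemma lin_unit:
  assumes "\<And>j. c j \<noteq> 0 \<Longrightarrow> j < n"
  shows "lin n unit_vec c = c"
proof
  fix l
  have "(\<Sum>j<n. c j * unit_vec j l) = (if l < n then c l else 0)"
    by (simp add: unit_vec_def if_distrib cong: if_cong)
  then show "lin n unit_vec c l = c l" using assms[of l] by (auto simp: lin_def)
qed

lemma lin_of_unit: "j < n \<Longrightarrow> lin n M (unit_vec j) = M j"
  by (auto simp: lin_def unit_vec_def fun_eq_iff if_distrib if_distribR cong: if_cong)

text \<open>
  A homogeneous element of degree \<open>\<alpha>\<close> of a multigraded free module is determined by one scalar
  for each basis element of degree at most \<open>\<alpha>\<close>, and a homogeneous map by one scalar for each pair
  of basis elements.  So a multigraded free complex is a sequence of scalar matrices, \<open>df i\<close> from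
  level \<open>Suc i\<close> to level \<open>i\<close>, that respect the degrees \<open>sh\<close> of the basis elements.
\<close>

record ('d, 'k) graded_complex =
  rk :: "nat \<Rightarrow> nat"
  sh :: "nat \<Rightarrow> nat \<Rightarrow> 'd"
  df :: "nat \<Rightarrow> nat \<Rightarrow> nat \<Rightarrow> 'k"

definition strand :: "('d::order, 'k::field) graded_complex \<Rightarrow> nat \<Rightarrow> 'd \<Rightarrow> (nat \<Rightarrow> 'k) set" where
  "strand C i \<alpha> = {c. \<forall>j. c j \<noteq> 0 \<longrightarrow> j < rk C i \<and> sh C i j \<le> \<alpha>}"

abbreviation bd :: "('d::order, 'k::field) graded_complex \<Rightarrow> nat \<Rightarrow> (nat \<Rightarrow> 'k) \<Rightarrow> nat \<Rightarrow> 'k" where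
  "bd C i \<equiv> lin (rk C (Suc i)) (df C i)"

definition homogeneous_map ::
    "('d::order, 'k::field) graded_complex \<Rightarrow> nat \<Rightarrow> ('d, 'k) graded_complex \<Rightarrow> nat \<Rightarrow>
     (nat \<Rightarrow> nat \<Rightarrow> 'k) \<Rightarrow> bool" where
  "homogeneous_map C i C' i' M \<longleftrightarrow> (\<forall>j<rk C i. M j \<in> strand C' i' (sh C i j))"

text \<open>
  Level \<open>0\<close> plays the part of the ring that contains the resolved ideal, and \<open>I \<alpha>\<close> is the
  degree \<open>\<alpha>\<close> part of the ideal, for the degrees \<open>\<alpha> \<in> P\<close>.  With the ring as a level of its own, the
  augmentation is treated like any other differential; exactness starts at level \<open>1\<close>, and at level
  \<open>0\<close> only the image is prescribed.
\<close>

definition resolves ::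
    "('d::order, 'k::field) graded_complex \<Rightarrow> 'd set \<Rightarrow> ('d \<Rightarrow> (nat \<Rightarrow> 'k) set) \<Rightarrow> bool" where
  "resolves C P I \<longleftrightarrow>
     (\<forall>i. homogeneous_map C (Suc i) C i (df C i)) \<and>
     (\<forall>i. \<forall>j<rk C (Suc i). sh C (Suc i) j \<in> P) \<and>
     (\<forall>\<alpha>\<in>P. bd C 0 ` strand C 1 \<alpha> = I \<alpha>) \<and>
     (\<forall>i. \<forall>\<alpha>\<in>P. {c \<in> strand C (Suc i) \<alpha>. bd C i c = 0} = bd C (Suc i) ` strand C (Suc (Suc i)) \<alpha>)"

lemma strandD: "c \<in> strand C i \<alpha> \<Longrightarrow> c j \<noteq> 0 \<Longrightarrow> j < rk C i \<and> sh C i j \<le> \<alpha>"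
  by (simp add: strand_def)

lemma strand_zero [simp]: "0 \<in> strand C i \<alpha>" "(\<lambda>_. 0) \<in> strand C i \<alpha>"
  by (simp_all add: strand_def)

lemma strand_diff: "c \<in> strand C i \<alpha> \<Longrightarrow> d \<in> strand C i \<alpha> \<Longrightarrow> (\<lambda>j. c j - d j) \<in> strand C i \<alpha>"
  by (auto simp: strand_def) (metis diff_zero)+

lemma strand_unit: "j < rk C i \<Longrightarrow> unit_vec j \<in> strand C i (sh C i j)"
  by (auto simp: strand_def unit_vec_def split: if_splits)

lemma lin_unit_strand: "c \<in> strand C i \<alpha> \<Longrightarrow> lin (rk C i) unit_vec c = c"
  by (rule lin_unit) (auto dest: strandD)

lemma lin_in_strand:
  assumes M: "homogeneous_map C i C' i' M" and c: "c \<in> strand C i \<alpha>"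
  shows "lin (rk C i) M c \<in> strand C' i' \<alpha>"
  unfolding strand_def
proof (intro CollectI allI impI)
  fix l assume "lin (rk C i) M c l \<noteq> 0"
  then obtain j where j: "j < rk C i" "c j * M j l \<noteq> 0"
    unfolding lin_def by (meson lessThan_iff sum.not_neutral_contains_not_neutral)
  then have "l < rk C' i'" "sh C' i' l \<le> sh C i j" "sh C i j \<le> \<alpha>"
    using M c unfolding homogeneous_map_def by (auto dest!: strandD)
  then show "l < rk C' i' \<and> sh C' i' l \<le> \<alpha>" by auto
qed

lemma homogeneous_map_comp:
  assumes "homogeneous_map C i C' i' M" "homogeneous_map C' i' C'' i'' N"
  shows "homogeneous_map C i C'' i'' (\<lambda>j. lin (rk C' i') N (M j))"
  using assms lin_in_strand unfolding homogeneous_map_def by blast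

subsection \<open>Existence of chain maps and of homotopies\<close>

text \<open>
  The comparison map of two resolutions of the same ideal: the identity on the ring, then on each
  basis element a lift through the next differential of what commutation requires.
\<close>

fun chain_map :: "('d::order, 'k::field) graded_complex \<Rightarrow> ('d, 'k) graded_complex \<Rightarrow>
    nat \<Rightarrow> nat \<Rightarrow> nat \<Rightarrow> 'k" where
  "chain_map C C' 0 = unit_vec"
| "chain_map C C' (Suc i) = (\<lambda>j. SOME c. c \<in> strand C' (Suc i) (sh C (Suc i) j) \<and>
      bd C' i c = lin (rk C i) (chain_map C C' i) (df C i j))"

lemma bd_bd:
  assumes C: "resolves C P I" and j: "j < rk C (Suc (Suc i))"
  shows "bd C i (df C (Suc i) j) = 0"
proof -
  have "unit_vec j \<in> strand C (Suc (Suc i)) (sh C (Suc (Suc i)) j)" "sh C (Suc (Suc i)) j \<in> P"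
    using C j by (auto simp: resolves_def intro: strand_unit)
  then have "bd C i (bd C (Suc i) (unit_vec j)) = 0"
    using C unfolding resolves_def by blast
  then show ?thesis using j by (simp add: lin_of_unit)
qed

lemma df_in_strand:
  "resolves C P I \<Longrightarrow> j < rk C (Suc i) \<Longrightarrow> df C i j \<in> strand C i (sh C (Suc i) j)"
  by (auto simp: resolves_def homogeneous_map_def)

lemma exact_lift:
  assumes C: "resolves C P I" and "\<alpha> \<in> P" "c \<in> strand C (Suc i) \<alpha>" "bd C i c = 0"
  shows "\<exists>d \<in> strand C (Suc (Suc i)) \<alpha>. bd C (Suc i) d = c"
proof -
  have "c \<in> {c \<in> strand C (Suc i) \<alpha>. bd C i c = 0}" using assms by simp
  also have "\<dots> = bd C (Suc i) ` strand C (Suc (Suc i)) \<alpha>"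
    using C assms(2) unfolding resolves_def by blast
  finally show ?thesis by auto
qed

text \<open>
  The lifts exist: at the first level because both complexes have the same image in the ring, and
  later because the element to be lifted is a cycle and the target is exact.
\<close>

lemma chain_map_spec:
  assumes C: "resolves C P I" and C': "resolves C' P I"
  shows "j < rk C (Suc i) \<Longrightarrow> chain_map C C' (Suc i) j \<in> strand C' (Suc i) (sh C (Suc i) j) \<and>
      bd C' i (chain_map C C' (Suc i) j) = lin (rk C i) (chain_map C C' i) (df C i j)"
proof (induction i arbitrary: j)
  case 0
  let ?\<alpha> = "sh C 1 j"
  have P: "?\<alpha> \<in> P" using C 0 by (auto simp: resolves_def)
  have "bd C 0 (unit_vec j) \<in> bd C 0 ` strand C 1 ?\<alpha>"
    using strand_unit[of j C 1] 0 by (intro imageI) simp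
  then have "df C 0 j \<in> bd C' 0 ` strand C' 1 ?\<alpha>"
    using C C' P 0 by (simp add: resolves_def lin_of_unit)
  moreover have "lin (rk C 0) unit_vec (df C 0 j) = df C 0 j"
    using lin_unit_strand df_in_strand[OF C 0] by blast
  ultimately have "\<exists>c. c \<in> strand C' (Suc 0) ?\<alpha> \<and>
      bd C' 0 c = lin (rk C 0) (chain_map C C' 0) (df C 0 j)" by auto
  from someI_ex[OF this] show ?case by simp
next
  case (Suc i)
  let ?\<alpha> = "sh C (Suc (Suc i)) j" and ?\<phi> = "chain_map C C'"
  let ?z = "lin (rk C (Suc i)) (?\<phi> (Suc i)) (df C (Suc i) j)"
  have P: "?\<alpha> \<in> P" using C Suc.prems by (auto simp: resolves_def)
  have hom: "homogeneous_map C (Suc i) C' (Suc i) (?\<phi> (Suc i))"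
    using Suc.IH unfolding homogeneous_map_def by blast
  have z: "?z \<in> strand C' (Suc i) ?\<alpha>"
    using lin_in_strand[OF hom df_in_strand[OF C Suc.prems]] .
  have "bd C' i ?z = lin (rk C (Suc i)) (\<lambda>j. bd C' i (?\<phi> (Suc i) j)) (df C (Suc i) j)"
    by (rule lin_comp)
  also have "\<dots> = lin (rk C (Suc i)) (\<lambda>j. lin (rk C i) (?\<phi> i) (df C i j)) (df C (Suc i) j)"
    using Suc.IH by (intro lin_cong) blast
  also have "\<dots> = lin (rk C i) (?\<phi> i) (bd C i (df C (Suc i) j))"
    by (rule lin_comp[symmetric])
  also have "\<dots> = 0" using bd_bd[OF C Suc.prems] by simp
  finally have "\<exists>c. c \<in> strand C' (Suc (Suc i)) ?\<alpha> \<and> bd C' (Suc i) c = ?z"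
    using exact_lift[OF C' P z] by blast
  from someI_ex[OF this] show ?case by simp
qed

lemma chain_map_homogeneous:
  assumes C: "resolves C P I" and C': "resolves C' P I"
    and base: "rk C' 0 = rk C 0" "sh C' 0 = sh C 0"
  shows "homogeneous_map C i C' i (chain_map C C' i)"
proof (cases i)
  case 0
  then show ?thesis
    using base strand_unit[of _ C' 0] by (simp add: homogeneous_map_def)
next
  case (Suc h)
  then show ?thesis
    using chain_map_spec[OF C C'] unfolding homogeneous_map_def by blast
qed

lemma chain_map_commutes:
  assumes C: "resolves C P I" and C': "resolves C' P I"
  shows "bd C' i (lin (rk C (Suc i)) (chain_map C C' (Suc i)) c) =
         lin (rk C i) (chain_map C C' i) (bd C i c)"
proof -
  have "bd C' i (lin (rk C (Suc i)) (chain_map C C' (Suc i)) c) =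
      lin (rk C (Suc i)) (\<lambda>j. bd C' i (chain_map C C' (Suc i) j)) c"
    by (rule lin_comp)
  also have "\<dots> = lin (rk C (Suc i)) (\<lambda>j. lin (rk C i) (chain_map C C' i) (df C i j)) c"
    using chain_map_spec[OF assms] by (intro lin_cong) blast
  finally show ?thesis by (simp add: lin_comp)
qed

text \<open>
  An endomorphism \<open>\<theta>\<close> of a resolution that is the identity in level \<open>0\<close> is homotopic to the
  identity: \<open>\<theta> - 1 = bd h + h bd\<close>.  Again each value of \<open>h\<close> is a lift through a differential, and
  \<open>h\<close> vanishes on the ring.
\<close>

fun homotopy :: "('d::order, 'k::field) graded_complex \<Rightarrow> (nat \<Rightarrow> nat \<Rightarrow> nat \<Rightarrow> 'k) \<Rightarrow>
    nat \<Rightarrow> nat \<Rightarrow> nat \<Rightarrow> 'k" where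
  "homotopy C \<theta> 0 = (\<lambda>_ _. 0)"
| "homotopy C \<theta> (Suc i) = (\<lambda>j. SOME c. c \<in> strand C (Suc (Suc i)) (sh C (Suc i) j) \<and>
      bd C (Suc i) c = (\<lambda>l. \<theta> (Suc i) j l - unit_vec j l - lin (rk C i) (homotopy C \<theta> i) (df C i j) l))"

lemma homotopy_spec:
  assumes C: "resolves C P I"
    and hom: "\<And>i. homogeneous_map C i C i (\<theta> i)"
    and chain: "\<And>i j. j < rk C (Suc i) \<Longrightarrow> bd C i (\<theta> (Suc i) j) = lin (rk C i) (\<theta> i) (df C i j)"
    and id: "\<And>j. j < rk C (Suc 0) \<Longrightarrow> lin (rk C 0) (\<theta> 0) (df C 0 j) = df C 0 j"
  shows "j < rk C (Suc i) \<Longrightarrow>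
    homotopy C \<theta> (Suc i) j \<in> strand C (Suc (Suc i)) (sh C (Suc i) j) \<and>
      bd C (Suc i) (homotopy C \<theta> (Suc i) j) =
        (\<lambda>l. \<theta> (Suc i) j l - unit_vec j l - lin (rk C i) (homotopy C \<theta> i) (df C i j) l)"
proof (induction i arbitrary: j)
  case 0
  let ?\<alpha> = "sh C (Suc 0) j" and ?z = "\<lambda>l. \<theta> (Suc 0) j l - unit_vec j l"
  have P: "?\<alpha> \<in> P" using C 0 by (auto simp: resolves_def)
  have z: "?z \<in> strand C (Suc 0) ?\<alpha>"
    using 0 hom[of "Suc 0"] by (intro strand_diff strand_unit) (auto simp: homogeneous_map_def)
  have "bd C 0 ?z = 0"
    using 0 id chain[OF 0] by (simp add: lin_diff lin_of_unit fun_eq_iff)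
  then have "\<exists>c. c \<in> strand C (Suc (Suc 0)) ?\<alpha> \<and> bd C (Suc 0) c = ?z"
    using exact_lift[OF C P z] by blast
  then have "\<exists>c. c \<in> strand C (Suc (Suc 0)) ?\<alpha> \<and> bd C (Suc 0) c =
      (\<lambda>l. \<theta> (Suc 0) j l - unit_vec j l - lin (rk C 0) (homotopy C \<theta> 0) (df C 0 j) l)"
    by (simp add: lin_def)
  from someI_ex[OF this] show ?case by simp
next
  case (Suc i)
  let ?\<alpha> = "sh C (Suc (Suc i)) j" and ?h = "homotopy C \<theta>" and ?d = "df C (Suc i) j"
  let ?z = "\<lambda>l. \<theta> (Suc (Suc i)) j l - unit_vec j l - lin (rk C (Suc i)) (?h (Suc i)) ?d l"
  have P: "?\<alpha> \<in> P" using C Suc.prems by (auto simp: resolves_def)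
  have hh: "homogeneous_map C (Suc i) C (Suc (Suc i)) (?h (Suc i))"
    using Suc.IH unfolding homogeneous_map_def by blast
  have d: "?d \<in> strand C (Suc i) ?\<alpha>" by (rule df_in_strand[OF C Suc.prems])
  have z: "?z \<in> strand C (Suc (Suc i)) ?\<alpha>"
    using Suc.prems hom[of "Suc (Suc i)"] lin_in_strand[OF hh d]
    by (intro strand_diff strand_unit) (auto simp: homogeneous_map_def)
  have dd: "bd C i ?d = 0" by (rule bd_bd[OF C Suc.prems])
  have "bd C (Suc i) (lin (rk C (Suc i)) (?h (Suc i)) ?d) =
      lin (rk C (Suc i)) (\<lambda>j. bd C (Suc i) (?h (Suc i) j)) ?d"
    by (rule lin_comp)
  also have "\<dots> = lin (rk C (Suc i))
      (\<lambda>j l. \<theta> (Suc i) j l - unit_vec j l - lin (rk C i) (?h i) (df C i j) l) ?d"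
    using Suc.IH by (intro lin_cong) blast
  also have "\<dots> = (\<lambda>l. lin (rk C (Suc i)) (\<theta> (Suc i)) ?d l - lin (rk C (Suc i)) unit_vec ?d l
      - lin (rk C (Suc i)) (\<lambda>j. lin (rk C i) (?h i) (df C i j)) ?d l)"
    by (simp add: lin_def right_diff_distrib sum_subtractf)
  also have "\<dots> = (\<lambda>l. lin (rk C (Suc i)) (\<theta> (Suc i)) ?d l - ?d l)"
    using dd by (simp add: lin_unit_strand[OF d] lin_comp[symmetric])
  finally have "bd C (Suc i) ?z = 0"
    using Suc.prems chain[OF Suc.prems] by (simp add: lin_diff lin_of_unit fun_eq_iff)
  then have "\<exists>c. c \<in> strand C (Suc (Suc (Suc i))) ?\<alpha> \<and> bd C (Suc (Suc i)) c = ?z"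
    using exact_lift[OF C P z] by blast
  from someI_ex[OF this] show ?case by simp
qed


subsection \<open>Independence of Tor from the resolution\<close>

text \<open>
  Tensoring with the residue field in degree \<open>\<alpha>\<close> kills all basis elements whose degree is
  not \<open>\<alpha>\<close>.
\<close>

definition residue :: "('d::order, 'k::field) graded_complex \<Rightarrow> nat \<Rightarrow> 'd \<Rightarrow> (nat \<Rightarrow> 'k) \<Rightarrow> nat \<Rightarrow> 'k" where
  "residue C i \<alpha> c = (\<lambda>l. if l < rk C i \<and> sh C i l = \<alpha> then c l else 0)"

definition residue_chains :: "('d::order, 'k::field) graded_complex \<Rightarrow> nat \<Rightarrow> 'd \<Rightarrow> (nat \<Rightarrow> 'k) set" where
  "residue_chains C i \<alpha> = {c. \<forall>j. c j \<noteq> 0 \<longrightarrow> j < rk C i \<and> sh C i j = \<alpha>}"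

text \<open>
  Level \<open>Suc i\<close> carries the homology in degree \<open>i\<close>.  The map to level \<open>0\<close> is the augmentation, which
  is not part of the tensored complex; so in degree \<open>0\<close> all chains are cycles.
\<close>

definition residue_cycles :: "('d::order, 'k::field) graded_complex \<Rightarrow> nat \<Rightarrow> 'd \<Rightarrow> (nat \<Rightarrow> 'k) set" where
  "residue_cycles C i \<alpha> = {c \<in> residue_chains C (Suc i) \<alpha>.
     case i of 0 \<Rightarrow> True | Suc h \<Rightarrow> residue C (Suc h) \<alpha> (bd C (Suc h) c) = 0}"

definition residue_boundaries :: "('d::order, 'k::field) graded_complex \<Rightarrow> nat \<Rightarrow> 'd \<Rightarrow> (nat \<Rightarrow> 'k) set" where
  "residue_boundaries C i \<alpha> =
     (\<lambda>c. residue C (Suc i) \<alpha> (bd C (Suc i) c)) ` residue_chains C (Suc (Suc i)) \<alpha>"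

lemma residue_chains_strand: "residue_chains C i \<alpha> \<subseteq> strand C i \<alpha>"
  by (auto simp: residue_chains_def strand_def)

lemma residue_in_chains: "residue C i \<alpha> c \<in> residue_chains C i \<alpha>"
  by (auto simp: residue_chains_def residue_def split: if_splits)

lemma residue_of_chain: "c \<in> residue_chains C i \<alpha> \<Longrightarrow> residue C i \<alpha> c = c"
  by (auto simp: residue_chains_def residue_def fun_eq_iff)

lemma residue_zero [simp]: "residue C i \<alpha> 0 = 0" "residue C i \<alpha> (\<lambda>_. 0) = 0"
  by (auto simp: residue_def fun_eq_iff)

lemma residue_add: "residue C i \<alpha> (\<lambda>j. c j + d j) = residue C i \<alpha> c + residue C i \<alpha> d"
  by (auto simp: residue_def fun_eq_iff)

lemma residue_diff: "residue C i \<alpha> (\<lambda>j. c j - d j) = residue C i \<alpha> c - residue C i \<alpha> d"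
  by (auto simp: residue_def fun_eq_iff)

lemma residue_scale: "residue C i \<alpha> (\<lambda>j. a * c j) = (\<lambda>j. a * residue C i \<alpha> c j)"
  by (auto simp: residue_def fun_eq_iff)

text \<open>
  A matrix entry from a basis element of degree below \<open>\<alpha>\<close> to one of degree \<open>\<alpha>\<close> vanishes, so
  homogeneous maps pass to the residues.
\<close>

lemma residue_lin_residue:
  assumes M: "homogeneous_map C i C' i' M" and c: "c \<in> strand C i \<alpha>"
  shows "residue C' i' \<alpha> (lin (rk C i) M (residue C i \<alpha> c)) = residue C' i' \<alpha> (lin (rk C i) M c)"
proof
  fix l
  have "(\<Sum>j<rk C i. residue C i \<alpha> c j * M j l) = (\<Sum>j<rk C i. c j * M j l)"
    if l: "l < rk C' i'" "sh C' i' l = \<alpha>"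
  proof (rule sum.cong[OF refl])
    fix j assume j: "j \<in> {..<rk C i}"
    show "residue C i \<alpha> c j * M j l = c j * M j l"
    proof (cases "c j \<noteq> 0 \<and> M j l \<noteq> 0")
      case True
      then have "sh C i j \<le> \<alpha>" "\<alpha> \<le> sh C i j"
        using strandD[OF c, of j] M j l(2) by (auto simp: homogeneous_map_def dest: strandD)
      then show ?thesis using j by (simp add: residue_def)
    qed (use j in \<open>auto simp: residue_def\<close>)
  qed
  then show "residue C' i' \<alpha> (lin (rk C i) M (residue C i \<alpha> c)) l =
      residue C' i' \<alpha> (lin (rk C i) M c) l"
    by (simp add: residue_def lin_def)
qed

lemma residue_lin_linear:
  "Vector_Spaces.linear (\<lambda>a (c :: nat \<Rightarrow> 'k::field) j. a * c j) (\<lambda>a (c :: nat \<Rightarrow> 'k) j. a * c j)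
     (\<lambda>c. residue C i \<alpha> (lin n M c))"
proof -
  have "residue C i \<alpha> (lin n M (b + c)) = residue C i \<alpha> (lin n M b) + residue C i \<alpha> (lin n M c)"
    for b c :: "nat \<Rightarrow> 'k"
    using lin_add[of n M b c] by (simp add: plus_fun_def residue_add[unfolded plus_fun_def])
  then show ?thesis
    unfolding Vector_Spaces.linear_iff
    by (auto simp: lin_scale residue_scale intro: coords.vector_space_axioms)
qed

lemma subspace_residue_chains: "coords.subspace (residue_chains C i \<alpha>)"
  by (auto simp: coords.subspace_def residue_chains_def) (metis add.right_neutral)+

lemma subspace_residue_boundaries: "coords.subspace (residue_boundaries C i \<alpha>)"
  unfolding residue_boundaries_def
  by (rule coords_pair.linear_subspace_image[OF residue_lin_linear subspace_residue_chains])

lemma subspace_residue_cycles: "coords.subspace (residue_cycles C i \<alpha>)"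
proof (cases i)
  case 0
  then show ?thesis by (simp add: residue_cycles_def subspace_residue_chains)
next
  case (Suc h)
  have "residue_cycles C i \<alpha> =
      residue_chains C (Suc i) \<alpha> \<inter> {c. residue C (Suc h) \<alpha> (bd C (Suc h) c) = 0}"
    by (auto simp: residue_cycles_def Suc)
  then show ?thesis
    using coords.subspace_inter[OF subspace_residue_chains
        coords_pair.linear_subspace_kernel[OF residue_lin_linear]] by simp
qed

lemma residue_chains_in_span:
  "residue_chains C i \<alpha> \<subseteq> coords.span (unit_vec ` {j. j < rk C i \<and> sh C i j = \<alpha>})"
  using supported_in_span[of "{j. j < rk C i \<and> sh C i j = \<alpha>}"] by (simp add: residue_chains_def)

lemma residue_cycles_in_span:
  "residue_cycles C i \<alpha> \<subseteq> coords.span (unit_vec ` {j. j < rk C (Suc i) \<and> sh C (Suc i) j = \<alpha>})"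
  using residue_chains_in_span[of C "Suc i" \<alpha>] by (auto simp: residue_cycles_def)

lemma residue_boundaries_subset_cycles:
  assumes C: "resolves C P I"
  shows "residue_boundaries C i \<alpha> \<subseteq> residue_cycles C i \<alpha>"
proof -
  have hom: "homogeneous_map C (Suc n) C n (df C n)" for n using C by (simp add: resolves_def)
  have "residue C (Suc h) \<alpha> (bd C (Suc h) (residue C (Suc i) \<alpha> (bd C (Suc i) c))) = 0"
    if "i = Suc h" "c \<in> residue_chains C (Suc (Suc i)) \<alpha>" for c h
  proof -
    have c: "c \<in> strand C (Suc (Suc i)) \<alpha>" using that(2) residue_chains_strand by blast
    have "residue C (Suc h) \<alpha> (bd C (Suc h) (residue C (Suc i) \<alpha> (bd C (Suc i) c))) =
        residue C (Suc h) \<alpha> (bd C (Suc h) (bd C (Suc i) c))"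
      using residue_lin_residue[OF hom lin_in_strand[OF hom c]] that(1) by simp
    also have "bd C (Suc h) (bd C (Suc i) c) = lin (rk C (Suc (Suc i))) (\<lambda>j. bd C (Suc h) (df C (Suc i) j)) c"
      by (rule lin_comp)
    also have "\<dots> = lin (rk C (Suc (Suc i))) (\<lambda>j. 0) c"
      using bd_bd[OF C] that(1) by (intro lin_cong) simp
    finally show ?thesis by (simp add: lin_def residue_def fun_eq_iff)
  qed
  then show ?thesis
    by (auto simp: residue_boundaries_def residue_cycles_def residue_in_chains split: nat.splits)
qed

text \<open>
  Let \<open>\<phi>\<close> and \<open>\<psi>\<close> be comparison maps in the two directions.  On residues, \<open>\<psi> \<phi>\<close> is homotopic to the
  identity, so a cycle whose image under \<open>\<phi>\<close> is a boundary is itself a boundary: \<open>\<phi>\<close> is injective on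
  homology.  By symmetry this inequality yields that the dimensions agree.
\<close>

lemma residue_dim_le:
  assumes C: "resolves C P I" and C': "resolves C' P I"
    and base: "rk C' 0 = rk C 0" "sh C' 0 = sh C 0"
  shows "coords.dim (residue_cycles C i \<alpha>) - coords.dim (residue_boundaries C i \<alpha>) \<le>
    coords.dim (residue_cycles C' i \<alpha>) - coords.dim (residue_boundaries C' i \<alpha>)"
proof -
  define \<phi> where "\<phi> = chain_map C C'"
  define \<psi> where "\<psi> = chain_map C' C"
  (* The composite of the two comparison maps, as an endomorphism of C. *)
  define \<theta> where "\<theta> = (\<lambda>n j. lin (rk C' n) (\<psi> n) (\<phi> n j))"
  define h where "h = homotopy C \<theta>"
  have hom: "homogeneous_map C (Suc n) C n (df C n)" "homogeneous_map C' (Suc n) C' n (df C' n)" for n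
    using C C' by (simp_all add: resolves_def)
  have \<phi>: "homogeneous_map C n C' n (\<phi> n)" for n
    unfolding \<phi>_def by (rule chain_map_homogeneous[OF C C' base])
  have \<psi>: "homogeneous_map C' n C n (\<psi> n)" for n
    unfolding \<psi>_def by (rule chain_map_homogeneous[OF C' C base[symmetric]])
  have \<phi>_bd: "bd C' n (lin (rk C (Suc n)) (\<phi> (Suc n)) c) = lin (rk C n) (\<phi> n) (bd C n c)" for n c
    unfolding \<phi>_def by (rule chain_map_commutes[OF C C'])
  have \<psi>_bd: "bd C n (lin (rk C' (Suc n)) (\<psi> (Suc n)) c) = lin (rk C' n) (\<psi> n) (bd C' n c)" for n c
    unfolding \<psi>_def by (rule chain_map_commutes[OF C' C])
  have \<theta>: "homogeneous_map C n C n (\<theta> n)" for n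
    unfolding \<theta>_def by (rule homogeneous_map_comp[OF \<phi> \<psi>])
  have \<theta>_lin: "lin (rk C n) (\<theta> n) c = lin (rk C' n) (\<psi> n) (lin (rk C n) (\<phi> n) c)" for n c
    unfolding \<theta>_def by (rule lin_comp[symmetric])
  have \<theta>_bd: "bd C n (\<theta> (Suc n) j) = lin (rk C n) (\<theta> n) (df C n j)" if j: "j < rk C (Suc n)" for n j
  proof -
    have "bd C n (\<theta> (Suc n) j) = lin (rk C' n) (\<psi> n) (bd C' n (\<phi> (Suc n) j))"
      by (simp add: \<theta>_def \<psi>_bd)
    also have "bd C' n (\<phi> (Suc n) j) = lin (rk C n) (\<phi> n) (df C n j)"
      using \<phi>_bd[of n "unit_vec j"] j by (simp add: lin_of_unit)
    finally show ?thesis by (simp add: \<theta>_lin)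
  qed
  have \<theta>0: "lin (rk C 0) (\<theta> 0) (df C 0 j) = df C 0 j" if "j < rk C (Suc 0)" for j
    using lin_unit_strand[OF df_in_strand[OF C that]] base
    by (simp add: \<theta>_lin \<phi>_def \<psi>_def)
  note h_spec = homotopy_spec[OF C \<theta> \<theta>_bd \<theta>0, folded h_def]
  have h: "homogeneous_map C n C (Suc n) (h n)" for n
  proof (cases n)
    case 0
    then show ?thesis by (simp add: homogeneous_map_def h_def)
  next
    case (Suc m)
    then show ?thesis using h_spec unfolding homogeneous_map_def by blast
  qed
  have homotopic: "c = (\<lambda>l. lin (rk C (Suc n)) (\<theta> (Suc n)) c l -
      bd C (Suc n) (lin (rk C (Suc n)) (h (Suc n)) c) l - lin (rk C n) (h n) (bd C n c) l)"
    if c: "c \<in> strand C (Suc n) \<beta>" for n c \<beta>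
  proof -
    have "bd C (Suc n) (lin (rk C (Suc n)) (h (Suc n)) c) =
        lin (rk C (Suc n)) (\<lambda>j. bd C (Suc n) (h (Suc n) j)) c"
      by (rule lin_comp)
    also have "\<dots> = lin (rk C (Suc n))
        (\<lambda>j l. \<theta> (Suc n) j l - unit_vec j l - lin (rk C n) (h n) (df C n j) l) c"
      using h_spec by (intro lin_cong) blast
    also have "\<dots> = (\<lambda>l. lin (rk C (Suc n)) (\<theta> (Suc n)) c l - lin (rk C (Suc n)) unit_vec c l
        - lin (rk C (Suc n)) (\<lambda>j. lin (rk C n) (h n) (df C n j)) c l)"
      by (simp add: lin_def right_diff_distrib sum_subtractf)
    finally show ?thesis
      by (simp add: lin_unit_strand[OF c] lin_comp[symmetric])
  qed
  let ?res = "residue C (Suc i) \<alpha>" and ?res' = "residue C' (Suc i) \<alpha>"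
  define f where "f = (\<lambda>c. ?res' (lin (rk C (Suc i)) (\<phi> (Suc i)) c))"
  show ?thesis
  proof (rule coords_pair.dim_subquotient_le[of f])
    show "Vector_Spaces.linear (\<lambda>a (c :: nat \<Rightarrow> 'b) j. a * c j) (\<lambda>a (c :: nat \<Rightarrow> 'b) j. a * c j) f"
      unfolding f_def by (rule residue_lin_linear)
    show "residue_cycles C i \<alpha> \<subseteq> coords.span (unit_vec ` {j. j < rk C (Suc i) \<and> sh C (Suc i) j = \<alpha>})"
      "residue_cycles C' i \<alpha> \<subseteq> coords.span (unit_vec ` {j. j < rk C' (Suc i) \<and> sh C' (Suc i) j = \<alpha>})"
      by (rule residue_cycles_in_span)+
    show "residue_boundaries C i \<alpha> \<subseteq> residue_cycles C i \<alpha>"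
      by (rule residue_boundaries_subset_cycles[OF C])
    show "residue_boundaries C' i \<alpha> \<subseteq> residue_cycles C' i \<alpha>"
      by (rule residue_boundaries_subset_cycles[OF C'])
  next
    fix c assume c: "c \<in> residue_cycles C i \<alpha>"
    then have cS: "c \<in> strand C (Suc i) \<alpha>"
      using residue_chains_strand by (auto simp: residue_cycles_def)
    have "residue C' (Suc n) \<alpha> (bd C' (Suc n) (f c)) = 0" if i: "i = Suc n" for n
    proof -
      have "residue C' (Suc n) \<alpha> (bd C' (Suc n) (f c)) =
          residue C' (Suc n) \<alpha> (bd C' (Suc n) (lin (rk C (Suc i)) (\<phi> (Suc i)) c))"
        using residue_lin_residue[OF hom(2) lin_in_strand[OF \<phi> cS]] i by (simp add: f_def)
      also have "\<dots> = residue C' (Suc n) \<alpha> (lin (rk C (Suc n)) (\<phi> (Suc n)) (bd C (Suc n) c))"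
        by (simp add: \<phi>_bd i)
      also have "\<dots> = residue C' (Suc n) \<alpha> (lin (rk C (Suc n)) (\<phi> (Suc n))
          (residue C (Suc n) \<alpha> (bd C (Suc n) c)))"
        using residue_lin_residue[OF \<phi> lin_in_strand[OF hom(1)]] cS i by simp
      also have "\<dots> = 0" using c i by (simp add: residue_cycles_def)
      finally show ?thesis .
    qed
    then show "f c \<in> residue_cycles C' i \<alpha>"
      by (auto simp: residue_cycles_def f_def residue_in_chains split: nat.splits)
  next
    fix c assume c: "c \<in> residue_cycles C i \<alpha>" and fc: "f c \<in> residue_boundaries C' i \<alpha>"
    have cS: "c \<in> strand C (Suc i) \<alpha>" and cr: "?res c = c"
      using c residue_chains_strand by (auto simp: residue_cycles_def residue_of_chain)
    obtain b where b: "b \<in> strand C' (Suc (Suc i)) \<alpha>" "f c = ?res' (bd C' (Suc i) b)"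
      using fc residue_chains_strand unfolding residue_boundaries_def by blast
    have bnd: "?res (bd C (Suc i) d) \<in> residue_boundaries C i \<alpha>" if "d \<in> strand C (Suc (Suc i)) \<alpha>" for d
      unfolding residue_boundaries_def residue_lin_residue[OF hom(1) that, symmetric]
      by (intro imageI residue_in_chains)
    have "?res (lin (rk C (Suc i)) (\<theta> (Suc i)) c) = ?res (lin (rk C' (Suc i)) (\<psi> (Suc i)) (f c))"
      unfolding \<theta>_lin f_def by (rule residue_lin_residue[OF \<psi> lin_in_strand[OF \<phi> cS], symmetric])
    also have "\<dots> = ?res (lin (rk C' (Suc i)) (\<psi> (Suc i)) (bd C' (Suc i) b))"
      unfolding b(2) by (rule residue_lin_residue[OF \<psi> lin_in_strand[OF hom(2) b(1)]])
    also have "\<dots> = ?res (bd C (Suc i) (lin (rk C' (Suc (Suc i))) (\<psi> (Suc (Suc i))) b))"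
      by (simp add: \<psi>_bd)
    finally have 1: "?res (lin (rk C (Suc i)) (\<theta> (Suc i)) c) \<in> residue_boundaries C i \<alpha>"
      using bnd[OF lin_in_strand[OF \<psi> b(1)]] by simp
    have 2: "?res (bd C (Suc i) (lin (rk C (Suc i)) (h (Suc i)) c)) \<in> residue_boundaries C i \<alpha>"
      by (rule bnd[OF lin_in_strand[OF h cS]])
    (* In degree 0 this holds because h vanishes on the ring, otherwise because c is a cycle. *)
    have 3: "?res (lin (rk C i) (h i) (bd C i c)) = 0"
    proof (cases i)
      case 0
      then show ?thesis by (simp add: h_def lin_def)
    next
      case (Suc n)
      have "?res (lin (rk C i) (h i) (bd C i c)) = ?res (lin (rk C i) (h i) (residue C i \<alpha> (bd C i c)))"
        by (rule residue_lin_residue[OF h lin_in_strand[OF hom(1) cS], symmetric])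
      then show ?thesis using c Suc by (simp add: residue_cycles_def)
    qed
    have "c = ?res (lin (rk C (Suc i)) (\<theta> (Suc i)) c) -
        ?res (bd C (Suc i) (lin (rk C (Suc i)) (h (Suc i)) c)) - ?res (lin (rk C i) (h i) (bd C i c))"
      using arg_cong[OF homotopic[OF cS], of ?res] by (simp add: cr residue_diff)
    then show "c \<in> residue_boundaries C i \<alpha>"
      using coords.subspace_diff[OF subspace_residue_boundaries 1 2] 3 by simp
  qed (auto intro: subspace_residue_boundaries subspace_residue_cycles)
qed

section \<open>Homogeneous matrices over a polynomial ring\<close>

abbreviation "lookup \<equiv> Poly_Mapping.lookup"
abbreviation "keys \<equiv> Poly_Mapping.keys"
abbreviation "single \<equiv> Poly_Mapping.single"

lemma monom_diff_add:
  fixes a b :: "'v monom"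
  assumes "lookup b \<le> lookup a"
  shows "(a - b) + b = a"
  using assms by (intro poly_mapping_eqI) (simp add: lookup_add lookup_minus le_fun_def)

lemma monom_add_diff: "(a + b) - b = (a :: 'v monom)"
  by (intro poly_mapping_eqI) (simp add: lookup_add lookup_minus)

lemma monom_diff_diff:
  fixes a b c :: "'v monom"
  assumes "lookup c \<le> lookup b" "lookup b \<le> lookup a"
  shows "(a - b) + (b - c) = a - c"
  using assms by (intro poly_mapping_eqI) (simp add: lookup_add lookup_minus le_fun_def)

lemma monom_le_add: "lookup b \<le> lookup (a + b :: 'v monom)"
  by (simp add: le_fun_def lookup_add)

lemma keys_monom_diff: "keys (a - b :: 'v monom) \<subseteq> keys a"
  by (auto simp: in_keys_iff lookup_minus)

lemma single_sum: "single m (\<Sum>j\<in>A. g j) = (\<Sum>j\<in>A. single m (g j))"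
  by (induction A rule: infinite_finite_induct) (auto simp: single_add)

lemma lookup_mult_single:
  fixes p :: "('v, 'k::field) mpoly"
  shows "lookup (p * single m a) n = (if lookup m \<le> lookup n then lookup p (n - m) * a else 0)"
proof -
  have p: "p = (\<Sum>k\<in>keys p. single k (lookup p k))"
  proof (rule poly_mapping_eqI)
    fix n
    show "lookup p n = lookup (\<Sum>k\<in>keys p. single k (lookup p k)) n"
      by (simp add: lookup_sum lookup_single when_def in_keys_iff)
  qed
  have "p * single m a = (\<Sum>k\<in>keys p. single (k + m) (lookup p k * a))"
    by (subst p) (simp add: sum_distrib_right mult_single)
  then have "lookup (p * single m a) n = (\<Sum>k\<in>keys p. if k + m = n then lookup p k * a else 0)"
    by (simp add: lookup_sum lookup_single when_def)
  also have "\<dots> = (\<Sum>k\<in>keys p. if k = n - m then (if lookup m \<le> lookup n then lookup p k * a else 0) else 0)"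
    by (intro sum.cong refl) (auto simp: monom_diff_add monom_add_diff monom_le_add)
  also have "\<dots> = (if lookup m \<le> lookup n then lookup p (n - m) * a else 0)"
    by (auto simp: in_keys_iff)
  finally show ?thesis .
qed

lemma polynomials_zero [simp]: "0 \<in> polynomials V"
  by (simp add: polynomials_def)

lemma polynomials_add: "p \<in> polynomials V \<Longrightarrow> q \<in> polynomials V \<Longrightarrow> p + q \<in> polynomials V"
  using keys_add[of p q] by (auto simp: polynomials_def)

lemma polynomials_mult:
  assumes p: "p \<in> polynomials V" and q: "q \<in> polynomials V"
  shows "p * q \<in> polynomials V"
  unfolding polynomials_def
proof (intro CollectI ballI)
  fix m assume "m \<in> keys (p * q)"
  then obtain a b where ab: "a \<in> keys p" "b \<in> keys q" "m = a + b"
    using keys_mult[of p q] by blast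
  then have "keys a \<subseteq> V" "keys b \<subseteq> V" using p q by (auto simp: polynomials_def)
  then show "keys m \<subseteq> V" using ab(3) keys_add[of a b] by auto
qed

lemma polynomials_sum: "(\<And>j. j \<in> A \<Longrightarrow> g j \<in> polynomials V) \<Longrightarrow> (\<Sum>j\<in>A. g j) \<in> polynomials V"
  by (induction A rule: infinite_finite_induct) (auto intro: polynomials_add)

lemma polynomials_single: "keys m \<subseteq> V \<Longrightarrow> single m a \<in> polynomials V"
  by (simp add: polynomials_def)

text \<open>
  The free module with basis degrees \<open>s\<close>: \<open>spread s \<alpha> c\<close> is the homogeneous element of degree
  \<open>\<alpha>\<close> with scalars \<open>c\<close>, and \<open>component s \<alpha> f\<close> reads off the scalars of the degree \<open>\<alpha>\<close>
  part of \<open>f\<close>.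
\<close>

definition spread :: "(nat \<Rightarrow> 'v monom) \<Rightarrow> 'v monom \<Rightarrow> (nat \<Rightarrow> 'k) \<Rightarrow> nat \<Rightarrow> ('v, 'k::field) mpoly" where
  "spread s \<alpha> c = (\<lambda>j. single (\<alpha> - s j) (c j))"

definition component :: "(nat \<Rightarrow> 'v monom) \<Rightarrow> 'v monom \<Rightarrow> (nat \<Rightarrow> ('v, 'k::field) mpoly) \<Rightarrow> nat \<Rightarrow> 'k" where
  "component s \<alpha> f = (\<lambda>j. if lookup (s j) \<le> lookup \<alpha> then lookup (f j) (\<alpha> - s j) else 0)"

lemma component_spread:
  "(\<And>j. c j \<noteq> 0 \<Longrightarrow> lookup (s j) \<le> lookup \<alpha>) \<Longrightarrow> component s \<alpha> (spread s \<alpha> c) = c"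
  by (auto simp: component_def spread_def fun_eq_iff)

lemma component_zero [simp]: "component s \<alpha> 0 = 0" "component s \<alpha> (\<lambda>_. 0) = 0"
  by (auto simp: component_def fun_eq_iff)

lemma spread_zero [simp]: "spread s \<alpha> 0 = 0" "spread s \<alpha> (\<lambda>_. 0) = 0"
  by (auto simp: spread_def fun_eq_iff)

text \<open>
  Since each entry of \<open>f\<close> has finitely many monomials, \<open>f\<close> is the sum of its homogeneous components
  over any finite set \<open>A\<close> of degrees that contains all the degrees that occur.
\<close>

lemma sum_of_components:
  assumes A: "finite A" "\<And>j m. m \<in> keys (f j) \<Longrightarrow> m + s j \<in> A"
  shows "(\<lambda>j. \<Sum>\<alpha>\<in>A. spread s \<alpha> (component s \<alpha> f) j) = f"
proof (intro ext poly_mapping_eqI)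
  fix j m
  have "lookup (\<Sum>\<alpha>\<in>A. spread s \<alpha> (component s \<alpha> f) j) m =
      (\<Sum>\<alpha>\<in>A. if \<alpha> - s j = m then (if lookup (s j) \<le> lookup \<alpha> then lookup (f j) m else 0) else 0)"
    by (auto simp: lookup_sum spread_def component_def lookup_single when_def intro!: sum.cong)
  also have "\<dots> = (\<Sum>\<alpha>\<in>A. if \<alpha> = m + s j then lookup (f j) m else 0)"
    by (intro sum.cong refl) (auto simp: monom_diff_add monom_add_diff monom_le_add)
  also have "\<dots> = lookup (f j) m"
    using A by (auto simp: in_keys_iff)
  finally show "lookup (\<Sum>\<alpha>\<in>A. spread s \<alpha> (component s \<alpha> f) j) m = lookup (f j) m" .
qed

lemma zero_if_components_zero:
  assumes "\<And>\<alpha>. component s \<alpha> f = 0"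
  shows "f = 0"
proof (rule ext, rule poly_mapping_eqI)
  fix j m
  have "component s (m + s j) f j = 0" using assms by simp
  then show "lookup (f j) m = lookup (0 j) m"
    by (simp add: component_def monom_le_add monom_add_diff)
qed

text \<open>
  The entries of a homogeneous matrix are monomials whose exponents are forced by the degrees of the
  basis elements, so only the scalar matrix \<open>D\<close> is free.  Passing to spreads and to components turns
  the action of \<open>M\<close> into that of \<open>D\<close>.
\<close>

locale homogeneous_matrix =
  fixes n :: nat and s s' :: "nat \<Rightarrow> 'v monom"
    and M :: "nat \<Rightarrow> nat \<Rightarrow> ('v, 'k::field) mpoly" and D :: "nat \<Rightarrow> nat \<Rightarrow> 'k"
  assumes entry_monomial: "j < n \<Longrightarrow> M j l = single (s j - s' l) (D j l)"
    and degree_le: "j < n \<Longrightarrow> D j l \<noteq> 0 \<Longrightarrow> lookup (s' l) \<le> lookup (s j)"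
begin

lemma lin_spread:
  assumes c: "\<And>j. c j \<noteq> 0 \<Longrightarrow> lookup (s j) \<le> lookup \<alpha>"
  shows "lin n M (spread s \<alpha> c) = spread s' \<alpha> (lin n D c)"
proof
  fix l
  have "single (\<alpha> - s j) (c j) * M j l = single (\<alpha> - s' l) (c j * D j l)" if j: "j < n" for j
  proof (cases "c j \<noteq> 0 \<and> D j l \<noteq> 0")
    case True
    then show ?thesis
      using c degree_le[OF j] by (simp add: entry_monomial[OF j] mult_single monom_diff_diff)
  qed (auto simp: entry_monomial[OF j])
  then show "lin n M (spread s \<alpha> c) l = spread s' \<alpha> (lin n D c) l"
    by (simp add: lin_def spread_def single_sum)
qed

lemma component_lin: "component s' \<alpha> (lin n M f) = lin n D (component s \<alpha> f)"
proof
  fix l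
  have *: "(if lookup (s' l) \<le> lookup \<alpha> then lookup (f j * M j l) (\<alpha> - s' l) else 0) =
      component s \<alpha> f j * D j l" if j: "j < n" for j
  proof (cases "D j l = 0")
    case False
    then have le: "lookup (s' l) \<le> lookup (s j)" by (rule degree_le[OF j])
    have "lookup (s' l) v \<le> lookup \<alpha> v \<and>
        lookup (s j) v - lookup (s' l) v \<le> lookup \<alpha> v - lookup (s' l) v \<longleftrightarrow>
        lookup (s j) v \<le> lookup \<alpha> v" for v
      using le_funD[OF le, of v] by linarith
    then have iff: "lookup (s' l) \<le> lookup \<alpha> \<and> lookup (s j - s' l) \<le> lookup (\<alpha> - s' l) \<longleftrightarrow>
        lookup (s j) \<le> lookup \<alpha>"
      unfolding le_fun_def lookup_minus by blast
    have "(\<alpha> - s' l) - (s j - s' l) = \<alpha> - s j"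
      using le by (intro poly_mapping_eqI) (simp add: lookup_minus le_fun_def)
    then show ?thesis
      using iff by (auto simp: entry_monomial[OF j] lookup_mult_single component_def)
  qed (simp add: entry_monomial[OF j])
  have "component s' \<alpha> (lin n M f) l =
      (\<Sum>j<n. if lookup (s' l) \<le> lookup \<alpha> then lookup (f j * M j l) (\<alpha> - s' l) else 0)"
    by (simp add: component_def lin_def lookup_sum)
  also have "\<dots> = (\<Sum>j<n. component s \<alpha> f j * D j l)"
    using * by (intro sum.cong) auto
  finally show "component s' \<alpha> (lin n M f) l = lin n D (component s \<alpha> f) l"
    by (simp add: lin_def)
qed

end

section \<open>Resolutions as graded complexes of scalar matrices\<close>

text \<open>
  The complex \<open>\<dots> \<rightarrow> F 1 \<rightarrow> F 0 \<rightarrow> S\<close>, with the ring \<open>S\<close> as level \<open>0\<close> and \<open>F i\<close> as level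
  \<open>Suc i\<close>.
\<close>

definition level_rank :: "('v, 'k::field) free_complex \<Rightarrow> nat \<Rightarrow> nat" where
  "level_rank F i = (case i of 0 \<Rightarrow> 1 | Suc h \<Rightarrow> fc_rank F h)"

definition level_shift :: "('v, 'k::field) free_complex \<Rightarrow> nat \<Rightarrow> nat \<Rightarrow> 'v monom" where
  "level_shift F i j = (case i of 0 \<Rightarrow> 0 | Suc h \<Rightarrow> fc_shift F h j)"

definition level_entry :: "('v, 'k::field) free_complex \<Rightarrow> nat \<Rightarrow> nat \<Rightarrow> nat \<Rightarrow> ('v, 'k) mpoly" where
  "level_entry F i j l = (if l < level_rank F i
     then (case i of 0 \<Rightarrow> fc_aug F j | Suc h \<Rightarrow> fc_diff F h j l) else 0)"

text \<open>
  Exponent vectors are turned into plain functions, for which \<open>\<le>\<close> is the pointwise order, that is,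
  divisibility of monomials.
\<close>

definition scalar_complex :: "('v, 'k::field) free_complex \<Rightarrow> ('v \<Rightarrow> nat, 'k) graded_complex" where
  "scalar_complex F = \<lparr>rk = level_rank F, sh = \<lambda>i j. lookup (level_shift F i j),
     df = \<lambda>i j l. lookup (level_entry F i j l) (level_shift F (Suc i) j - level_shift F i l)\<rparr>"

lemma scalar_complex_simps [simp]:
  "rk (scalar_complex F) = level_rank F"
  "sh (scalar_complex F) i j = lookup (level_shift F i j)"
  "df (scalar_complex F) i j l =
     lookup (level_entry F i j l) (level_shift F (Suc i) j - level_shift F i l)"
  by (simp_all add: scalar_complex_def)

lemma level_simps [simp]:
  "level_rank F 0 = 1" "level_rank F (Suc i) = fc_rank F i"
  "level_shift F 0 j = 0" "level_shift F (Suc i) j = fc_shift F i j"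
  by (simp_all add: level_rank_def level_shift_def)

definition level_module :: "'v set \<Rightarrow> ('v, 'k::field) free_complex \<Rightarrow> nat \<Rightarrow> (nat \<Rightarrow> ('v, 'k) mpoly) set" where
  "level_module V F i = {f. \<forall>j. f j \<in> polynomials V \<and> (j \<ge> level_rank F i \<longrightarrow> f j = 0)}"

abbreviation level_map ::
    "('v, 'k::field) free_complex \<Rightarrow> nat \<Rightarrow> (nat \<Rightarrow> ('v, 'k) mpoly) \<Rightarrow> nat \<Rightarrow> ('v, 'k) mpoly" where
  "level_map F i \<equiv> lin (level_rank F (Suc i)) (level_entry F i)"

lemma level_module_Suc: "level_module V F (Suc i) = fc_module V F i"
  by (simp add: level_module_def fc_module_def)

lemma level_map_0: "level_map F 0 f = (\<lambda>l. if l = 0 then aug_map F f else 0)"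
  by (auto simp: lin_def aug_map_def level_entry_def fun_eq_iff)

lemma level_map_Suc: "level_map F (Suc i) f = diff_map F i f"
  by (auto simp: lin_def diff_map_def level_entry_def fun_eq_iff)

definition homogeneous_entries :: "'v set \<Rightarrow> ('v, 'k::field) free_complex \<Rightarrow> bool" where
  "homogeneous_entries V F \<longleftrightarrow>
     (\<forall>i. \<forall>j<fc_rank F i. keys (fc_shift F i j) \<subseteq> V) \<and>
     (\<forall>i. \<forall>j<level_rank F (Suc i). \<forall>l<level_rank F i. \<forall>m \<in> keys (level_entry F i j l).
        keys m \<subseteq> V \<and> m + level_shift F i l = level_shift F (Suc i) j)"

lemma all_nat_split: "(\<forall>i. P i) \<longleftrightarrow> P 0 \<and> (\<forall>i. P (Suc i))"
  by (metis nat.exhaust)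

text \<open>
  Numbering the levels from the ring on merges the two clauses for the augmentation with the clauses
  for the differentials.
\<close>

lemma graded_free_resolution_levels:
  "graded_free_resolution V I F \<longleftrightarrow> homogeneous_entries V F \<and>
     aug_map F ` fc_module V F 0 = I \<and>
     (\<forall>i. {f \<in> level_module V F (Suc i). level_map F i f = 0} =
        level_map F (Suc i) ` level_module V F (Suc (Suc i)))"
proof -
  have ker0: "{f \<in> level_module V F (Suc 0). level_map F 0 f = 0} =
      {f \<in> fc_module V F 0. aug_map F f = 0}"
    by (auto simp: level_map_0 level_module_Suc fun_eq_iff simp del: level_simps)
  have exact: "(\<forall>i. {f \<in> level_module V F (Suc i). level_map F i f = 0} =
        level_map F (Suc i) ` level_module V F (Suc (Suc i))) \<longleftrightarrow>
      {f \<in> fc_module V F 0. aug_map F f = 0} = diff_map F 0 ` fc_module V F 1 \<and>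
      (\<forall>i. {f \<in> fc_module V F (Suc i). diff_map F i f = 0} =
        diff_map F (Suc i) ` fc_module V F (Suc (Suc i)))"
    by (subst all_nat_split, subst ker0) (simp add: level_map_Suc level_module_Suc del: level_simps)
  let ?Q = "\<lambda>i. \<forall>j<level_rank F (Suc i). \<forall>l<level_rank F i. \<forall>m \<in> keys (level_entry F i j l).
        keys m \<subseteq> V \<and> m + level_shift F i l = level_shift F (Suc i) j"
  have "?Q 0 \<longleftrightarrow> (\<forall>j<fc_rank F 0. fc_aug F j \<in> polynomials V \<and>
        (\<forall>m \<in> keys (fc_aug F j). m = fc_shift F 0 j))"
    by (auto simp: level_entry_def polynomials_def)
  moreover have "?Q (Suc i) \<longleftrightarrow>
      (\<forall>j<fc_rank F (Suc i). \<forall>l<fc_rank F i. fc_diff F i j l \<in> polynomials V \<and>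
        (\<forall>m \<in> keys (fc_diff F i j l). m + fc_shift F i l = fc_shift F (Suc i) j))" for i
    by (auto simp: level_entry_def polynomials_def)
  ultimately have entries: "homogeneous_entries V F \<longleftrightarrow>
     (\<forall>i. \<forall>j<fc_rank F i. keys (fc_shift F i j) \<subseteq> V) \<and>
     (\<forall>j<fc_rank F 0. fc_aug F j \<in> polynomials V \<and>
        (\<forall>m \<in> keys (fc_aug F j). m = fc_shift F 0 j)) \<and>
     (\<forall>i. \<forall>j<fc_rank F (Suc i). \<forall>l<fc_rank F i. fc_diff F i j l \<in> polynomials V \<and>
        (\<forall>m \<in> keys (fc_diff F i j l). m + fc_shift F i l = fc_shift F (Suc i) j))"
    unfolding homogeneous_entries_def all_nat_split[of ?Q] by simp
  show ?thesis
    by (simp only: graded_free_resolution_def exact entries conj_assoc)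
qed

lemma homogeneous_entry:
  fixes p :: "('v, 'k::field) mpoly"
  assumes p: "\<And>m. m \<in> keys p \<Longrightarrow> m + b = a"
  shows "p = single (a - b) (lookup p (a - b))"
    and "lookup p (a - b) \<noteq> 0 \<Longrightarrow> lookup b \<le> lookup a"
proof -
  have eq: "m = a - b" if "m \<in> keys p" for m
    using p[OF that] monom_add_diff[of m b] by simp
  show "p = single (a - b) (lookup p (a - b))"
    using eq by (intro poly_mapping_eqI) (auto simp: lookup_single when_def in_keys_iff)
  assume "lookup p (a - b) \<noteq> 0"
  then have "(a - b) + b = a" using p by (simp add: in_keys_iff)
  then show "lookup b \<le> lookup a" using monom_le_add[of b "a - b"] by simp
qed

lemma homogeneous_entriesD:
  assumes "homogeneous_entries V F"
  shows "homogeneous_matrix (level_rank F (Suc i)) (level_shift F (Suc i)) (level_shift F i)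
    (level_entry F i) (df (scalar_complex F) i)"
proof
  fix j l assume j: "j < level_rank F (Suc i)"
  have keys: "m + level_shift F i l = level_shift F (Suc i) j"
    if "m \<in> keys (level_entry F i j l)" for m
    using assms j that unfolding homogeneous_entries_def
    by (cases "l < level_rank F i") (auto simp: level_entry_def)
  show "level_entry F i j l =
      single (level_shift F (Suc i) j - level_shift F i l) (df (scalar_complex F) i j l)"
    using homogeneous_entry(1)[OF keys] by simp
  show "lookup (level_shift F i l) \<le> lookup (level_shift F (Suc i) j)"
    if "df (scalar_complex F) i j l \<noteq> 0"
    using homogeneous_entry(2)[OF keys] that by simp
qed

lemma homogeneous_entries_scalar:
  assumes "homogeneous_entries V F"
  shows "homogeneous_map (scalar_complex F) (Suc i) (scalar_complex F) i (df (scalar_complex F) i)"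
proof -
  interpret homogeneous_matrix "level_rank F (Suc i)" "level_shift F (Suc i)" "level_shift F i"
    "level_entry F i" "df (scalar_complex F) i"
    by (rule homogeneous_entriesD[OF assms])
  show ?thesis
    using degree_le by (auto simp: homogeneous_map_def strand_def level_entry_def split: if_splits)
qed

lemma level_module_finite_degrees:
  assumes "f \<in> level_module V F i"
  obtains A where "finite A" "\<And>j m. m \<in> keys (f j) \<Longrightarrow> m + s j \<in> A"
proof
  let ?A = "\<Union>j<level_rank F i. (\<lambda>m. m + s j) ` keys (f j)"
  show "finite ?A" by simp
  fix j m assume m: "m \<in> keys (f j)"
  then have "f j \<noteq> 0" by auto
  then have "j < level_rank F i"
    using assms by (force simp: level_module_def not_le[symmetric])
  then show "m + s j \<in> ?A" using m by blast
qed

lemma component_in_strand: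
  assumes "f \<in> level_module V F i"
  shows "component (level_shift F i) \<alpha> f \<in> strand (scalar_complex F) i (lookup \<alpha>)"
  using assms
  by (auto simp: strand_def component_def level_module_def not_le[symmetric] split: if_splits)

lemma spread_in_module:
  assumes c: "c \<in> strand (scalar_complex F) i (lookup \<alpha>)" and \<alpha>: "keys \<alpha> \<subseteq> V"
  shows "spread (level_shift F i) \<alpha> c \<in> level_module V F i"
proof -
  have "single (\<alpha> - level_shift F i j) (c j) \<in> polynomials V" for j
    by (rule polynomials_single[OF subset_trans[OF keys_monom_diff \<alpha>]])
  moreover have "c j = 0" if "level_rank F i \<le> j" for j
    using strandD[OF c, of j] that by (metis not_le scalar_complex_simps(1))
  ultimately show ?thesis by (simp add: spread_def level_module_def)
qed

lemma component_spread_strand: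
  "c \<in> strand (scalar_complex F) i (lookup \<alpha>) \<Longrightarrow>
     component (level_shift F i) \<alpha> (spread (level_shift F i) \<alpha> c) = c"
  by (intro component_spread) (auto dest: strandD)

text \<open>The degree \<open>d\<close> part of an ideal, as scalars on the single basis element of level \<open>0\<close>.\<close>

definition ideal_strand :: "('v, 'k::field) mpoly set \<Rightarrow> ('v \<Rightarrow> nat) \<Rightarrow> (nat \<Rightarrow> 'k) set" where
  "ideal_strand I d = {c. (\<forall>j. c j \<noteq> 0 \<longrightarrow> j = 0) \<and> (\<forall>\<alpha>. lookup \<alpha> = d \<longrightarrow> single \<alpha> (c 0) \<in> I)}"

abbreviation monomial_degrees :: "'v set \<Rightarrow> ('v \<Rightarrow> nat) set" where
  "monomial_degrees V \<equiv> lookup ` {\<alpha>. keys \<alpha> \<subseteq> V}"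

text \<open>
  Exactness over the polynomial ring restricts to each degree: spread a scalar cycle, lift it, and
  take the component of the lift in the same degree.
\<close>

lemma scalar_complex_resolves:
  assumes R: "graded_free_resolution V I F"
  shows "resolves (scalar_complex F) (monomial_degrees V) (ideal_strand I)"
proof -
  let ?C = "scalar_complex F"
  have ent: "homogeneous_entries V F" and I: "aug_map F ` fc_module V F 0 = I"
    and exact: "\<And>i. {f \<in> level_module V F (Suc i). level_map F i f = 0} =
        level_map F (Suc i) ` level_module V F (Suc (Suc i))"
    using R by (auto simp: graded_free_resolution_levels)
  interpret hm: homogeneous_matrix "level_rank F (Suc i)" "level_shift F (Suc i)" "level_shift F i"
    "level_entry F i" "df (scalar_complex F) i" for i
    by (rule homogeneous_entriesD[OF ent])
  have spread: "level_map F i (spread (level_shift F (Suc i)) \<alpha> c) = spread (level_shift F i) \<alpha> (bd ?C i c)"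
    if "c \<in> strand ?C (Suc i) (lookup \<alpha>)" for i \<alpha> c
    using hm.lin_spread[of c i \<alpha>] strandD[OF that] by simp
  have shifts: "sh ?C (Suc i) j \<in> monomial_degrees V" if "j < rk ?C (Suc i)" for i j
    using ent that by (auto simp: homogeneous_entries_def)
  have hom: "homogeneous_map ?C (Suc i) ?C i (df ?C i)" for i
    by (rule homogeneous_entries_scalar[OF ent])
  have ideal: "bd ?C 0 ` strand ?C 1 (lookup \<alpha>) = ideal_strand I (lookup \<alpha>)" if \<alpha>: "keys \<alpha> \<subseteq> V" for \<alpha>
  proof (intro equalityI subsetI)
    fix b assume "b \<in> bd ?C 0 ` strand ?C 1 (lookup \<alpha>)"
    then obtain c where c: "c \<in> strand ?C (Suc 0) (lookup \<alpha>)" "b = bd ?C 0 c" by auto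
    have b: "b \<in> strand ?C 0 (lookup \<alpha>)"
      using lin_in_strand[OF hom c(1)] c(2) by simp
    have "single \<alpha> (b 0) = level_map F 0 (spread (level_shift F (Suc 0)) \<alpha> c) 0"
      using spread[OF c(1)] c(2) by (simp add: spread_def)
    also have "\<dots> \<in> aug_map F ` fc_module V F 0"
      using spread_in_module[OF c(1) \<alpha>] by (simp add: level_map_0 level_module_Suc del: level_simps)
    finally show "b \<in> ideal_strand I (lookup \<alpha>)"
      using strandD[OF b] I by (auto simp: ideal_strand_def lookup_inject)
  next
    fix b assume b: "b \<in> ideal_strand I (lookup \<alpha>)"
    then have "single \<alpha> (b 0) \<in> aug_map F ` fc_module V F 0"
      using I by (simp add: ideal_strand_def)
    then obtain f where f: "f \<in> fc_module V F 0" "single \<alpha> (b 0) = aug_map F f" by auto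
    have "level_map F 0 f = (\<lambda>l. if l = 0 then single \<alpha> (b 0) else 0)"
      by (simp only: level_map_0 f(2))
    then have "component (level_shift F 0) \<alpha> (level_map F 0 f) = b"
      using b by (auto simp: component_def ideal_strand_def fun_eq_iff le_fun_def)
    then have "bd ?C 0 (component (level_shift F (Suc 0)) \<alpha> f) = b"
      by (simp add: hm.component_lin[of 0, simplified])
    moreover have "component (level_shift F (Suc 0)) \<alpha> f \<in> strand ?C (Suc 0) (lookup \<alpha>)"
      using f(1) by (intro component_in_strand) (simp add: level_module_Suc)
    ultimately show "b \<in> bd ?C 0 ` strand ?C 1 (lookup \<alpha>)" by force
  qed
  have exact_strand: "{c \<in> strand ?C (Suc i) (lookup \<alpha>). bd ?C i c = 0} = bd ?C (Suc i) ` strand ?C (Suc (Suc i)) (lookup \<alpha>)"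
    if \<alpha>: "keys \<alpha> \<subseteq> V" for i \<alpha>
  proof (intro equalityI subsetI)
    fix c assume "c \<in> {c \<in> strand ?C (Suc i) (lookup \<alpha>). bd ?C i c = 0}"
    then have c: "c \<in> strand ?C (Suc i) (lookup \<alpha>)" "bd ?C i c = 0" by auto
    then have "spread (level_shift F (Suc i)) \<alpha> c \<in> {f \<in> level_module V F (Suc i). level_map F i f = 0}"
      using spread[OF c(1)] spread_in_module[OF c(1) \<alpha>] by simp
    then obtain g where g: "g \<in> level_module V F (Suc (Suc i))"
      "spread (level_shift F (Suc i)) \<alpha> c = level_map F (Suc i) g"
      unfolding exact by auto
    then have "c = bd ?C (Suc i) (component (level_shift F (Suc (Suc i))) \<alpha> g)"
      using component_spread_strand[OF c(1)] hm.component_lin[of "Suc i" \<alpha> g] by simp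
    then show "c \<in> bd ?C (Suc i) ` strand ?C (Suc (Suc i)) (lookup \<alpha>)"
      using component_in_strand[OF g(1)] by blast
  next
    fix c assume "c \<in> bd ?C (Suc i) ` strand ?C (Suc (Suc i)) (lookup \<alpha>)"
    then obtain d where d: "d \<in> strand ?C (Suc (Suc i)) (lookup \<alpha>)" "c = bd ?C (Suc i) d" by auto
    have c: "c \<in> strand ?C (Suc i) (lookup \<alpha>)"
      using lin_in_strand[OF hom d(1)] d(2) by simp
    have "level_map F (Suc i) (spread (level_shift F (Suc (Suc i))) \<alpha> d) \<in>
        {f \<in> level_module V F (Suc i). level_map F i f = 0}"
      unfolding exact using spread_in_module[OF d(1) \<alpha>] by blast
    then have "spread (level_shift F i) \<alpha> (bd ?C i c) = 0"
      using spread[OF d(1)] spread[OF c] d(2) by simp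
    then have "bd ?C i c = 0"
      using component_spread_strand[OF lin_in_strand[OF hom c]] by simp
    then show "c \<in> {c \<in> strand ?C (Suc i) (lookup \<alpha>). bd ?C i c = 0}" using c by simp
  qed
  show ?thesis
    unfolding resolves_def
  proof (intro conjI allI impI ballI)
    fix d assume "d \<in> monomial_degrees V"
    then obtain \<alpha> where \<alpha>: "keys \<alpha> \<subseteq> V" "d = lookup \<alpha>" by auto
    show "bd ?C 0 ` strand ?C 1 d = ideal_strand I d"
      unfolding \<alpha>(2) by (rule ideal[OF \<alpha>(1)])
    show "{c \<in> strand ?C (Suc i) d. bd ?C i c = 0} = bd ?C (Suc i) ` strand ?C (Suc (Suc i)) d" for i
      unfolding \<alpha>(2) by (rule exact_strand[OF \<alpha>(1)])
  qed (rule hom, rule shifts)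
qed

text \<open>
  Conversely, exactness in every degree gives exactness over the polynomial ring: lift the finitely
  many nonzero components of a cycle one by one, and add up the spread lifts.
\<close>

lemma resolution_of_scalar_exactness:
  assumes ent: "homogeneous_entries V F" and I: "aug_map F ` fc_module V F 0 = I"
    and exact: "\<And>i \<alpha>. {c \<in> strand (scalar_complex F) (Suc i) \<alpha>. bd (scalar_complex F) i c = 0} =
      bd (scalar_complex F) (Suc i) ` strand (scalar_complex F) (Suc (Suc i)) \<alpha>"
  shows "graded_free_resolution V I F"
proof -
  let ?C = "scalar_complex F"
  interpret hm: homogeneous_matrix "level_rank F (Suc i)" "level_shift F (Suc i)" "level_shift F i"
    "level_entry F i" "df (scalar_complex F) i" for i
    by (rule homogeneous_entriesD[OF ent])
  have hom: "homogeneous_map ?C (Suc i) ?C i (df ?C i)" for i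
    by (rule homogeneous_entries_scalar[OF ent])
  have comp: "component (level_shift F i) \<alpha> (level_map F i f) = bd ?C i (component (level_shift F (Suc i)) \<alpha> f)"
    for i \<alpha> f using hm.component_lin[of i \<alpha> f] by simp
  have spread: "level_map F i (spread (level_shift F (Suc i)) \<alpha> c) = spread (level_shift F i) \<alpha> (bd ?C i c)"
    if "c \<in> strand ?C (Suc i) (lookup \<alpha>)" for i \<alpha> c
    using hm.lin_spread[of c i \<alpha>] strandD[OF that] by simp
  have "{f \<in> level_module V F (Suc i). level_map F i f = 0} =
        level_map F (Suc i) ` level_module V F (Suc (Suc i))" for i
  proof (intro equalityI subsetI)
    fix f assume "f \<in> {f \<in> level_module V F (Suc i). level_map F i f = 0}"
    then have f: "f \<in> level_module V F (Suc i)" "level_map F i f = 0" by auto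
    obtain A where A: "finite A" "\<And>j m. m \<in> keys (f j) \<Longrightarrow> m + level_shift F (Suc i) j \<in> A"
      using level_module_finite_degrees[OF f(1), of "level_shift F (Suc i)"] by blast
    let ?c = "\<lambda>\<alpha>. component (level_shift F (Suc i)) \<alpha> f"
    have lift: "\<exists>d \<in> strand ?C (Suc (Suc i)) (lookup \<alpha>). bd ?C (Suc i) d = ?c \<alpha>" for \<alpha>
    proof -
      have "?c \<alpha> \<in> {c \<in> strand ?C (Suc i) (lookup \<alpha>). bd ?C i c = 0}"
        using component_in_strand[OF f(1)] comp[of i \<alpha> f] f(2) by simp
      then show ?thesis unfolding exact by auto
    qed
    then obtain d where d: "\<And>\<alpha>. d \<alpha> \<in> strand ?C (Suc (Suc i)) (lookup \<alpha>)"
      "\<And>\<alpha>. bd ?C (Suc i) (d \<alpha>) = ?c \<alpha>" by metis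
    (* The restriction to monomials in V keeps the coefficients of the lift in k[V]; it loses
       nothing, because all degrees that occur in f are monomials in V. *)
    define B where "B = {\<alpha> \<in> A. keys \<alpha> \<subseteq> V}"
    define g where "g = (\<lambda>j. \<Sum>\<alpha>\<in>B. spread (level_shift F (Suc (Suc i))) \<alpha> (d \<alpha>) j)"
    have B: "finite B" using A(1) by (simp add: B_def)
    have deg_B: "m + level_shift F (Suc i) j \<in> B" if m: "m \<in> keys (f j)" for j m
    proof -
      have "f j \<noteq> 0" using m by auto
      then have "j < fc_rank F i" using f(1) by (force simp: level_module_def not_le[symmetric])
      then have "keys (level_shift F (Suc i) j) \<subseteq> V" using ent by (simp add: homogeneous_entries_def)
      moreover have "keys m \<subseteq> V" using f(1) m by (auto simp: level_module_def polynomials_def)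
      ultimately show ?thesis
        using A(2)[OF m] keys_add[of m "level_shift F (Suc i) j"] by (auto simp: B_def)
    qed
    have sum_f: "(\<lambda>j. \<Sum>\<alpha>\<in>B. spread (level_shift F (Suc i)) \<alpha> (?c \<alpha>) j) = f"
      by (rule sum_of_components[OF B deg_B])
    have g: "g \<in> level_module V F (Suc (Suc i))"
      using spread_in_module[OF d(1), of _ V]
      by (auto simp: level_module_def g_def B_def intro!: polynomials_sum sum.neutral)
    have "level_map F (Suc i) g =
        (\<lambda>l. \<Sum>\<alpha>\<in>B. level_map F (Suc i) (spread (level_shift F (Suc (Suc i))) \<alpha> (d \<alpha>)) l)"
      by (auto simp: lin_def g_def sum_distrib_right fun_eq_iff intro: sum.swap)
    also have "\<dots> = f"
      by (simp only: spread[OF d(1)] d(2) sum_f)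
    finally show "f \<in> level_map F (Suc i) ` level_module V F (Suc (Suc i))"
      using g by blast
  next
    fix f assume "f \<in> level_map F (Suc i) ` level_module V F (Suc (Suc i))"
    then obtain g where g: "g \<in> level_module V F (Suc (Suc i))" "f = level_map F (Suc i) g" by auto
    have entry: "level_entry F (Suc i) j l \<in> polynomials V" if "j < level_rank F (Suc (Suc i))" for j l
      using ent that unfolding homogeneous_entries_def polynomials_def
      by (cases "l < level_rank F (Suc i)") (blast, simp add: level_entry_def)
    have f: "f \<in> level_module V F (Suc i)"
      using g(1) entry unfolding g(2)
      by (auto simp: level_module_def lin_def level_entry_def[of F "Suc i"]
          intro!: polynomials_sum polynomials_mult)
    have "component (level_shift F i) \<alpha> (level_map F i f) = 0" for \<alpha>
    proof -
      have "bd ?C (Suc i) (component (level_shift F (Suc (Suc i))) \<alpha> g) \<in>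
          {c \<in> strand ?C (Suc i) (lookup \<alpha>). bd ?C i c = 0}"
        unfolding exact using component_in_strand[OF g(1)] by blast
      then show ?thesis unfolding g(2) comp by blast
    qed
    then show "f \<in> {f \<in> level_module V F (Suc i). level_map F i f = 0}"
      using f zero_if_components_zero by blast
  qed
  then show ?thesis
    using ent I by (simp add: graded_free_resolution_levels)
qed

text \<open>The homology that defines Betti numbers is that of the residues of the scalar complex.\<close>

lemma tor_chains_eq: "tor_chains F i \<alpha> = residue_chains (scalar_complex F) (Suc i) (lookup \<alpha>)"
  by (simp add: tor_chains_def residue_chains_def lookup_inject)

text \<open>
  The constant coefficient of a homogeneous entry is nonzero only if the two basis elements have the
  same degree.
\<close>

lemma tor_map_eq:
  assumes ent: "homogeneous_entries V F" and c: "c \<in> tor_chains F (Suc i) \<alpha>"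
  shows "tor_map F i c = residue (scalar_complex F) (Suc i) (lookup \<alpha>) (bd (scalar_complex F) (Suc i) c)"
proof
  fix l
  interpret hm: homogeneous_matrix "fc_rank F (Suc i)" "fc_shift F (Suc i)" "fc_shift F i"
    "level_entry F (Suc i)" "df (scalar_complex F) (Suc i)"
    using homogeneous_entriesD[OF ent, of "Suc i"] by (simp add: level_shift_def[abs_def])
  have "c j * lookup (fc_diff F i j l) 0 =
      (if fc_shift F i l = \<alpha> then c j * df (scalar_complex F) (Suc i) j l else 0)"
    if l: "l < fc_rank F i" and j: "j < fc_rank F (Suc i)" for j
  proof (cases "c j = 0")
    case False
    then have \<alpha>: "fc_shift F (Suc i) j = \<alpha>" using c by (auto simp: tor_chains_def)
    have diff: "fc_diff F i j l = single (\<alpha> - fc_shift F i l) (df (scalar_complex F) (Suc i) j l)"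
      using hm.entry_monomial[OF j, of l] l \<alpha> by (simp add: level_entry_def del: scalar_complex_simps)
    show ?thesis
    proof (cases "df (scalar_complex F) (Suc i) j l = 0")
      case True
      then show ?thesis using diff by (simp del: scalar_complex_simps)
    next
      case nz: False
      then have "(\<alpha> - fc_shift F i l) + fc_shift F i l = \<alpha>"
        using hm.degree_le[OF j] \<alpha> by (intro monom_diff_add) (simp del: scalar_complex_simps)
      then have "\<alpha> - fc_shift F i l = 0 \<longleftrightarrow> fc_shift F i l = \<alpha>"
        using monom_add_diff[of 0 \<alpha>] by auto
      then show ?thesis using diff by (simp add: lookup_single when_def del: scalar_complex_simps)
    qed
  qed simp
  then show "tor_map F i c l =
      residue (scalar_complex F) (Suc i) (lookup \<alpha>) (bd (scalar_complex F) (Suc i) c) l"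
    by (auto simp: tor_map_def residue_def lin_def lookup_inject simp del: scalar_complex_simps(3) intro!: sum.cong)
qed

lemma tor_cycles_eq:
  assumes "homogeneous_entries V F"
  shows "tor_cycles F i \<alpha> = residue_cycles (scalar_complex F) i (lookup \<alpha>)"
  using tor_map_eq[OF assms]
  by (cases i) (auto simp: tor_cycles_def residue_cycles_def tor_chains_eq)

lemma tor_boundaries_eq:
  assumes "homogeneous_entries V F"
  shows "tor_boundaries F i \<alpha> = residue_boundaries (scalar_complex F) i (lookup \<alpha>)"
  using tor_map_eq[OF assms] by (auto simp: tor_boundaries_def residue_boundaries_def tor_chains_eq)

text \<open>
  The inequality of \<open>residue_dim_le\<close>, applied to \<open>F\<close> and the resolution chosen in the definition of
  \<open>betti\<close> in both orders.
\<close>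

lemma betti_eq:
  fixes F :: "('v, 'k::field) free_complex"
  assumes F: "graded_free_resolution V I F"
  shows "betti V I i \<alpha> = vec_dim (tor_cycles F i \<alpha>) - vec_dim (tor_boundaries F i \<alpha>)"
proof -
  have le: "vec_dim (tor_cycles F i \<alpha>) - vec_dim (tor_boundaries F i \<alpha>) \<le>
      vec_dim (tor_cycles F' i \<alpha>) - vec_dim (tor_boundaries F' i \<alpha>)"
    if "graded_free_resolution V I F" "graded_free_resolution V I F'" for F F' :: "('v, 'k) free_complex"
  proof -
    have "homogeneous_entries V F" "homogeneous_entries V F'"
      using that by (auto simp: graded_free_resolution_levels)
    then show ?thesis
      using residue_dim_le[OF that[THEN scalar_complex_resolves], of i "lookup \<alpha>"]
      by (simp add: vec_dim_eq tor_cycles_eq tor_boundaries_eq fun_eq_iff)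
  qed
  define F' :: "('v, 'k) free_complex" where "F' = (SOME F. graded_free_resolution V I F)"
  have "graded_free_resolution V I F'" unfolding F'_def using F by (rule someI)
  then show ?thesis
    using le[OF F] le[OF _ F] by (simp add: betti_def F'_def[symmetric] Let_def le_antisym)
qed

section \<open>The Taylor resolution\<close>

lemma lookup_indicator_degree:
  "finite W \<Longrightarrow> lookup (indicator_degree W) v = (if v \<in> W then 1 else 0)"
  by (simp add: indicator_degree_def lookup_sum lookup_single when_def)

lemma indicator_degree_eq_iff:
  assumes "finite W" "finite W'"
  shows "indicator_degree W = indicator_degree W' \<longleftrightarrow> W = W'"
proof
  assume eq: "indicator_degree W = indicator_degree W'"
  have "v \<in> W \<longleftrightarrow> v \<in> W'" for v
    using arg_cong[OF eq, of "\<lambda>m. lookup m v"] assms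
    by (simp add: lookup_indicator_degree split: if_splits)
  then show "W = W'" by blast
qed simp

lemma indicator_degree_mono:
  "W \<subseteq> W' \<Longrightarrow> finite W' \<Longrightarrow> lookup (indicator_degree W) \<le> lookup (indicator_degree W')"
  using finite_subset[of W W'] by (auto simp: le_fun_def lookup_indicator_degree)

lemma keys_indicator_degree: "finite W \<Longrightarrow> keys (indicator_degree W) = W"
  by (auto simp: in_keys_iff lookup_indicator_degree split: if_splits)

lemma prod_var: "finite e \<Longrightarrow> (\<Prod>v\<in>e. var v :: ('v, 'k::field) mpoly) = single (indicator_degree e) 1"
proof (induction e rule: finite_induct)
  case empty
  then show ?case by (simp add: indicator_degree_def flip: single_one)
next
  case (insert v e)
  then show ?case by (simp add: var_def mult_single indicator_degree_def)
qed

text \<open>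
  Cancelling the terms of the ordered pairs \<open>(e, f)\<close> and \<open>(f, e)\<close> against each other, rather than
  showing that the sum equals its own negative, covers fields of characteristic \<open>2\<close>.
\<close>

lemma antisymmetric_sum_zero:
  fixes g :: "'a \<Rightarrow> 'a \<Rightarrow> 'b::ab_group_add" and pos :: "'a \<Rightarrow> nat"
  assumes fin: "finite A" and pos: "inj_on pos A"
    and g: "\<And>e f. e \<in> A \<Longrightarrow> f \<in> A \<Longrightarrow> e \<noteq> f \<Longrightarrow> g e f = - g f e"
  shows "(\<Sum>e\<in>A. \<Sum>f\<in>A - {e}. g e f) = 0"
proof -
  have split: "(\<Sum>f\<in>A - {e}. g e f) = (\<Sum>f\<in>A. if pos e < pos f then g e f else 0) +
      (\<Sum>f\<in>A. if pos f < pos e then g e f else 0)" if e: "e \<in> A" for e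
  proof -
    have "(\<Sum>f\<in>A - {e}. g e f) = (\<Sum>f\<in>A. if f = e then 0 else g e f)"
      using fin e by (simp add: sum.remove[of A e])
    also have "\<dots> = (\<Sum>f\<in>A. (if pos e < pos f then g e f else 0) + (if pos f < pos e then g e f else 0))"
      using pos e by (intro sum.cong) (auto simp: inj_on_def dest: not_less_iff_gr_or_eq[THEN iffD1])
    finally show ?thesis by (simp add: sum.distrib)
  qed
  have "(\<Sum>e\<in>A. \<Sum>f\<in>A. if pos f < pos e then g e f else 0) =
      (\<Sum>f\<in>A. \<Sum>e\<in>A. if pos f < pos e then g e f else 0)"
    by (rule sum.swap)
  also have "\<dots> = (\<Sum>f\<in>A. \<Sum>e\<in>A. - (if pos f < pos e then g f e else 0))"
    using g by (intro sum.cong) auto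
  finally show ?thesis
    by (simp add: split sum.distrib sum_negf)
qed

text \<open>
  An enumeration of the sets of \<open>i\<close> edges for each \<open>i\<close>, and a linear order of the edges given by
  their positions.  The sets of \<open>i\<close> edges are the \<open>(i - 1)\<close>-dimensional faces of a simplex.
\<close>

locale enumerated_simplex =
  fixes E :: "'v set set" and pos :: "'v set \<Rightarrow> nat" and face :: "nat \<Rightarrow> nat \<Rightarrow> 'v set set"
  assumes finite_E: "finite E" and finite_edge: "e \<in> E \<Longrightarrow> finite e"
    and inj_pos: "inj_on pos E"
    and bij_face: "bij_betw (face i) {..<card {\<sigma>. \<sigma> \<subseteq> E \<and> card \<sigma> = i}} {\<sigma>. \<sigma> \<subseteq> E \<and> card \<sigma> = i}"
begin

abbreviation faces :: "nat \<Rightarrow> 'v set set set" where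
  "faces i \<equiv> {\<sigma>. \<sigma> \<subseteq> E \<and> card \<sigma> = i}"

definition face_index :: "nat \<Rightarrow> 'v set set \<Rightarrow> nat" where
  "face_index i = inv_into {..<card (faces i)} (face i)"

definition sign :: "'v set set \<Rightarrow> 'v set \<Rightarrow> 'k::field" where
  "sign \<sigma> e = (-1) ^ card {f \<in> \<sigma>. pos f < pos e}"

text \<open>
  The sum has at most one nonzero term; written as a sum, it can be interchanged with the sums of
  the differential.
\<close>

definition incidence :: "'v set set \<Rightarrow> 'v set set \<Rightarrow> 'k::field" where
  "incidence \<sigma> \<tau> = (\<Sum>e\<in>E - \<tau>. if \<sigma> = insert e \<tau> then sign \<sigma> e else 0)"

definition taylor :: "('v, 'k::field) free_complex" where
  "taylor = \<lparr>fc_rank = \<lambda>i. card (faces (Suc i)),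
     fc_shift = \<lambda>i j. indicator_degree (\<Union>(face (Suc i) j)),
     fc_aug = \<lambda>j. single (indicator_degree (\<Union>(face (Suc 0) j))) 1,
     fc_diff = \<lambda>i j l. single (indicator_degree (\<Union>(face (Suc (Suc i)) j)) -
         indicator_degree (\<Union>(face (Suc i) l))) (incidence (face (Suc (Suc i)) j) (face (Suc i) l))\<rparr>"

lemma taylor_simps [simp]:
  "fc_rank taylor i = card (faces (Suc i))"
  "fc_shift taylor i j = indicator_degree (\<Union>(face (Suc i) j))"
  "fc_aug taylor j = single (indicator_degree (\<Union>(face (Suc 0) j))) 1"
  "fc_diff taylor i j l = single (indicator_degree (\<Union>(face (Suc (Suc i)) j)) -
         indicator_degree (\<Union>(face (Suc i) l))) (incidence (face (Suc (Suc i)) j) (face (Suc i) l))"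
  by (simp_all add: taylor_def)

lemma finite_faces [simp]: "finite (faces i)"
  using finite_E by simp

lemma finite_face: "\<sigma> \<subseteq> E \<Longrightarrow> finite \<sigma>"
  using finite_E finite_subset by blast

lemma finite_Union_face: "\<sigma> \<subseteq> E \<Longrightarrow> finite (\<Union>\<sigma>)"
  using finite_face finite_edge by auto

lemma face_in: "j < card (faces i) \<Longrightarrow> face i j \<subseteq> E \<and> card (face i j) = i"
  using bij_face[of i] by (auto simp: bij_betw_def)

lemma face_index_less: "\<sigma> \<in> faces i \<Longrightarrow> face_index i \<sigma> < card (faces i)"
  using bij_betw_inv_into[OF bij_face[of i]] bij_betwE by (fastforce simp: face_index_def)

lemma face_face_index: "\<sigma> \<in> faces i \<Longrightarrow> face i (face_index i \<sigma>) = \<sigma>"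
  unfolding face_index_def using bij_betw_inv_into_right[OF bij_face[of i]] by blast

lemma face_index_face: "j < card (faces i) \<Longrightarrow> face_index i (face i j) = j"
  unfolding face_index_def using bij_betw_inv_into_left[OF bij_face[of i]] by blast

lemma faces_0: "faces 0 = {{}}"
  using finite_face by auto

lemma face_0: "face 0 0 = {}"
  using face_in[of 0 0] finite_face by (force simp: faces_0)

subsection \<open>The boundary of the simplex\<close>

lemma sign_nonzero: "(sign \<sigma> e :: 'k::field) \<noteq> 0"
  by (simp add: sign_def)

lemma sign_square: "sign \<sigma> e * sign \<sigma> e = (1 :: 'k::field)"
  unfolding sign_def power_mult_distrib[symmetric] by simp

lemma sign_remove:
  assumes "finite \<sigma>" "e \<in> \<sigma>"
  shows "sign (\<sigma> - {e}) f = (if pos e < pos f then - sign \<sigma> f else sign \<sigma> f :: 'k::field)"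
proof (cases "pos e < pos f")
  case True
  have "{g \<in> \<sigma>. pos g < pos f} = insert e {g \<in> \<sigma> - {e}. pos g < pos f}" using True assms by auto
  then have "card {g \<in> \<sigma>. pos g < pos f} = Suc (card {g \<in> \<sigma> - {e}. pos g < pos f})"
    using assms by simp
  then show ?thesis using True by (simp add: sign_def)
next
  case False
  then have "{g \<in> \<sigma>. pos g < pos f} = {g \<in> \<sigma> - {e}. pos g < pos f}" by auto
  then show ?thesis using False by (simp add: sign_def)
qed

lemma sign_anticommute:
  assumes "\<sigma> \<subseteq> E" "e \<in> \<sigma>" "f \<in> \<sigma>" "e \<noteq> f"
  shows "sign (\<sigma> - {f}) e * sign \<sigma> f = - (sign (\<sigma> - {e}) f * sign \<sigma> e :: 'k::field)"
proof -
  have "pos e \<noteq> pos f" using inj_pos assms by (auto simp: inj_on_def)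
  then show ?thesis
    using assms finite_face[of \<sigma>] by (auto simp: sign_remove)
qed

definition boundary :: "('v set set \<Rightarrow> 'k::field) \<Rightarrow> 'v set set \<Rightarrow> 'k" where
  "boundary c \<tau> = (\<Sum>e\<in>E - \<tau>. sign (insert e \<tau>) e * c (insert e \<tau>))"

definition cone :: "'v set \<Rightarrow> ('v set set \<Rightarrow> 'k::field) \<Rightarrow> 'v set set \<Rightarrow> 'k" where
  "cone a c \<sigma> = (if a \<in> \<sigma> then sign \<sigma> a * c (\<sigma> - {a}) else 0)"

lemma boundary_boundary:
  assumes \<tau>: "\<tau> \<subseteq> E"
  shows "boundary (boundary c) \<tau> = (0 :: 'k::field)"
proof -
  let ?g = "\<lambda>e f. sign (insert e \<tau>) e * (sign (insert f (insert e \<tau>)) f * c (insert f (insert e \<tau>)))"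
  have "boundary (boundary c) \<tau> = (\<Sum>e\<in>E - \<tau>. \<Sum>f\<in>E - \<tau> - {e}. ?g e f)"
    unfolding boundary_def sum_distrib_left by (intro sum.cong) auto
  also have "\<dots> = 0"
  proof (rule antisymmetric_sum_zero)
    show "finite (E - \<tau>)" using finite_E by simp
    show "inj_on pos (E - \<tau>)" using inj_pos by (rule inj_on_subset) auto
    fix e f assume ef: "e \<in> E - \<tau>" "f \<in> E - \<tau>" "e \<noteq> f"
    define \<sigma> where "\<sigma> = insert e (insert f \<tau>)"
    have *: "insert f (insert e \<tau>) = \<sigma>" "insert e (insert f \<tau>) = \<sigma>" "insert e \<tau> = \<sigma> - {f}" "insert f \<tau> = \<sigma> - {e}"
      using ef by (auto simp: \<sigma>_def)
    have "sign (\<sigma> - {f}) e * sign \<sigma> f = - (sign (\<sigma> - {e}) f * sign \<sigma> e :: 'k)"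
      using ef \<tau> by (intro sign_anticommute) (auto simp: \<sigma>_def)
    then have "sign (\<sigma> - {f}) e * sign \<sigma> f * c \<sigma> = - (sign (\<sigma> - {e}) f * sign \<sigma> e) * c \<sigma>"
      by simp
    then show "?g e f = - ?g f e"
      unfolding *(1,2) unfolding *(3,4) by (simp add: mult.assoc)
  qed
  finally show ?thesis .
qed

text \<open>The simplex is contractible: coning off from the vertex \<open>a\<close> is a contracting homotopy.\<close>

lemma cone_homotopy:
  assumes \<tau>: "\<tau> \<subseteq> E" and a: "a \<in> E"
  shows "boundary (cone a c) \<tau> + cone a (boundary c) \<tau> = (c \<tau> :: 'k::field)"
proof (cases "a \<in> \<tau>")
  case False
  have "boundary (cone a c) \<tau> =
      (\<Sum>e\<in>E - \<tau>. if e = a then sign (insert a \<tau>) a * (sign (insert a \<tau>) a * c \<tau>) else 0)"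
    unfolding boundary_def using False by (intro sum.cong) (auto simp: cone_def)
  also have "\<dots> = c \<tau>"
    using False a finite_E by (simp add: sign_square flip: mult.assoc)
  finally show ?thesis using False by (simp add: cone_def)
next
  case True
  let ?\<rho> = "\<tau> - {a}"
  have split: "E - ?\<rho> = insert a (E - \<tau>)" "a \<notin> E - \<tau>" "insert a ?\<rho> = \<tau>"
    using True a by auto
  have "boundary c ?\<rho> = sign \<tau> a * c \<tau> + (\<Sum>e\<in>E - \<tau>. sign (insert e ?\<rho>) e * c (insert e ?\<rho>))"
    unfolding boundary_def split(1) using split(2,3) finite_E by simp
  then have "cone a (boundary c) \<tau> =
      c \<tau> + (\<Sum>e\<in>E - \<tau>. sign \<tau> a * (sign (insert e ?\<rho>) e * c (insert e ?\<rho>)))"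
    using True by (simp add: cone_def distrib_left sum_distrib_left sign_square flip: mult.assoc)
  moreover have "boundary (cone a c) \<tau> =
      - (\<Sum>e\<in>E - \<tau>. sign \<tau> a * (sign (insert e ?\<rho>) e * c (insert e ?\<rho>)))"
    unfolding boundary_def sum_negf[symmetric]
  proof (intro sum.cong refl)
    fix e assume e: "e \<in> E - \<tau>"
    define \<sigma> where "\<sigma> = insert e \<tau>"
    have *: "insert e ?\<rho> = \<sigma> - {a}" "\<tau> = \<sigma> - {e}" using e True by (auto simp: \<sigma>_def)
    have "sign (\<sigma> - {a}) e * sign \<sigma> a = - (sign (\<sigma> - {e}) a * sign \<sigma> e :: 'k)"
      using e True \<tau> by (intro sign_anticommute) (auto simp: \<sigma>_def)
    then have anti: "sign (\<sigma> - {a}) e * sign \<sigma> a = - (sign \<tau> a * sign \<sigma> e :: 'k)"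
      unfolding *(2)[symmetric] .
    have "sign \<sigma> e * sign \<sigma> a =
        (sign (\<sigma> - {a}) e * sign (\<sigma> - {a}) e) * (sign \<sigma> e * sign \<sigma> a :: 'k)"
      by (simp add: sign_square)
    also have "\<dots> = (sign (\<sigma> - {a}) e * sign \<sigma> a) * (sign (\<sigma> - {a}) e * sign \<sigma> e)"
      by (simp add: mult_ac)
    also have "\<dots> = - (sign \<tau> a * sign (\<sigma> - {a}) e) * (sign \<sigma> e * sign \<sigma> e)"
      unfolding anti by (simp add: mult_ac)
    also have "\<dots> = - (sign \<tau> a * sign (\<sigma> - {a}) e)"
      by (simp add: sign_square)
    finally have "sign \<sigma> e * sign \<sigma> a * c (\<sigma> - {a}) =
        - (sign \<tau> a * sign (\<sigma> - {a}) e) * c (\<sigma> - {a})" by simp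
    moreover have "a \<in> \<sigma>" using True by (simp add: \<sigma>_def)
    ultimately show "sign (insert e \<tau>) e * cone a c (insert e \<tau>) =
        - (sign \<tau> a * (sign (insert e ?\<rho>) e * c (insert e ?\<rho>)))"
      unfolding \<sigma>_def[symmetric] *(1) by (simp add: cone_def mult.assoc)
  qed
  ultimately show ?thesis by simp
qed

subsection \<open>Exactness\<close>

definition on_faces :: "nat \<Rightarrow> (nat \<Rightarrow> 'k::field) \<Rightarrow> 'v set set \<Rightarrow> 'k" where
  "on_faces i c \<sigma> = (if \<sigma> \<in> faces i then c (face_index i \<sigma>) else 0)"

lemma level_rank_taylor: "level_rank taylor i = card (faces i)"
  by (cases i) (simp_all add: faces_0)

lemma level_shift_taylor: "j < card (faces i) \<Longrightarrow> level_shift taylor i j = indicator_degree (\<Union>(face i j))"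
  by (cases i) (simp_all add: faces_0 face_0 indicator_degree_def)

lemma incidence_insert: "e \<in> E - \<tau> \<Longrightarrow> incidence (insert e \<tau>) \<tau> = (sign (insert e \<tau>) e :: 'k::field)"
proof -
  assume e: "e \<in> E - \<tau>"
  have "incidence (insert e \<tau>) \<tau> = (\<Sum>f\<in>E - \<tau>. if f = e then sign (insert e \<tau>) e else 0 :: 'k)"
    unfolding incidence_def using e by (intro sum.cong) auto
  then show ?thesis using e finite_E by simp
qed

lemma incidence_nonzeroD:
  "(incidence \<sigma> \<tau> :: 'k::field) \<noteq> 0 \<Longrightarrow> \<exists>e \<in> E - \<tau>. \<sigma> = insert e \<tau>"
  by (rule ccontr) (auto simp: incidence_def intro!: sum.neutral elim!: notE)

lemma level_entry_taylor:
  assumes "j < card (faces (Suc i))" "l < card (faces i)"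
  shows "level_entry taylor i j l = single (indicator_degree (\<Union>(face (Suc i) j)) -
    indicator_degree (\<Union>(face i l))) (incidence (face (Suc i) j) (face i l) :: 'k::field)"
proof (cases i)
  case 0
  then have l: "l = 0" using assms by (simp add: faces_0)
  obtain e where e: "face (Suc 0) j = {e}" "e \<in> E"
    using face_in[of j "Suc 0"] assms 0 by (auto simp: card_Suc_eq)
  have none: "{f \<in> {e}. pos f < pos e} = {}" by blast
  have "incidence {e} {} = (1 :: 'k)"
    using incidence_insert[of e "{}"] e(2) by (simp only: sign_def none) simp
  then show ?thesis
    using 0 l e by (simp add: level_entry_def face_0 indicator_degree_def)
next
  case (Suc h)
  then show ?thesis using assms by (simp add: level_entry_def)
qed

lemma df_taylor:
  assumes "j < card (faces (Suc i))" "l < card (faces i)"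
  shows "df (scalar_complex taylor) i j l = (incidence (face (Suc i) j) (face i l) :: 'k::field)"
  using assms by (simp add: level_entry_taylor level_shift_taylor del: level_simps)

lemma homogeneous_entries_taylor:
  assumes E: "E \<subseteq> Pow V"
  shows "homogeneous_entries V (taylor :: ('v, 'k::field) free_complex)"
  unfolding homogeneous_entries_def
proof (intro conjI allI impI ballI)
  have keys: "keys (indicator_degree (\<Union>(face i j))) \<subseteq> V" if "j < card (faces i)" for i j
    using face_in[OF that] E finite_Union_face by (auto simp: keys_indicator_degree)
  show "keys (fc_shift (taylor :: ('v, 'k) free_complex) i j) \<subseteq> V"
    if "j < fc_rank (taylor :: ('v, 'k) free_complex) i" for i j
    using keys that by simp
  fix i j l m
  assume jl: "j < level_rank (taylor :: ('v, 'k) free_complex) (Suc i)"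
      "l < level_rank (taylor :: ('v, 'k) free_complex) i"
    and m: "m \<in> keys (level_entry (taylor :: ('v, 'k) free_complex) i j l)"
  then have j: "j < card (faces (Suc i))" and l: "l < card (faces i)"
    by (simp_all add: level_rank_taylor)
  let ?a = "indicator_degree (\<Union>(face (Suc i) j))" and ?b = "indicator_degree (\<Union>(face i l))"
  have m_eq: "m = ?a - ?b" and nz: "(incidence (face (Suc i) j) (face i l) :: 'k) \<noteq> 0"
    using m unfolding level_entry_taylor[OF j l] by (auto split: if_splits)
  from incidence_nonzeroD[OF nz] obtain e where "face (Suc i) j = insert e (face i l)" by blast
  then have "lookup ?b \<le> lookup ?a"
    using face_in[OF j] by (intro indicator_degree_mono finite_Union_face) auto
  then show "m + level_shift (taylor :: ('v, 'k) free_complex) i l =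
      level_shift (taylor :: ('v, 'k) free_complex) (Suc i) j"
    unfolding level_shift_taylor[OF j] level_shift_taylor[OF l] m_eq by (rule monom_diff_add)
  show "keys m \<subseteq> V"
    unfolding m_eq by (rule subset_trans[OF keys_monom_diff keys[OF j]])
qed

text \<open>
  Read as functions on edge sets, the scalar differentials of the Taylor complex are the boundary
  map of the simplex; the empty face is the basis element of the ring.
\<close>

lemma bd_taylor:
  assumes l: "l < card (faces i)"
  shows "bd (scalar_complex taylor) i c l = (boundary (on_faces (Suc i) c) (face i l) :: 'k::field)"
proof -
  let ?\<tau> = "face i l"
  have \<tau>: "?\<tau> \<subseteq> E" "card ?\<tau> = i" using face_in[OF l] by auto
  have "bd (scalar_complex taylor) i c l =
      (\<Sum>j<card (faces (Suc i)). on_faces (Suc i) c (face (Suc i) j) * incidence (face (Suc i) j) ?\<tau>)"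
    unfolding lin_def
  proof (rule sum.cong)
    fix j assume "j \<in> {..<card (faces (Suc i))}"
    then have j: "j < card (faces (Suc i))" by simp
    then show "c j * df (scalar_complex taylor) i j l =
        on_faces (Suc i) c (face (Suc i) j) * incidence (face (Suc i) j) ?\<tau>"
      using face_in[OF j] face_index_face[OF j]
      unfolding df_taylor[OF j l] by (simp add: on_faces_def)
  qed (simp add: level_rank_taylor del: level_simps)
  also have "\<dots> = (\<Sum>\<sigma>\<in>faces (Suc i). on_faces (Suc i) c \<sigma> * incidence \<sigma> ?\<tau>)"
    by (rule sum.reindex_bij_betw[OF bij_face])
  also have "\<dots> = (\<Sum>\<sigma>\<in>faces (Suc i). \<Sum>e\<in>E - ?\<tau>.
      if \<sigma> = insert e ?\<tau> then sign \<sigma> e * on_faces (Suc i) c \<sigma> else 0)"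
    by (auto simp: incidence_def sum_distrib_left intro!: sum.cong)
  also have "\<dots> = (\<Sum>e\<in>E - ?\<tau>. \<Sum>\<sigma>\<in>faces (Suc i).
      if \<sigma> = insert e ?\<tau> then sign \<sigma> e * on_faces (Suc i) c \<sigma> else 0)"
    by (rule sum.swap)
  also have "\<dots> = boundary (on_faces (Suc i) c) ?\<tau>"
    unfolding boundary_def
  proof (rule sum.cong[OF refl])
    fix e assume e: "e \<in> E - ?\<tau>"
    then have "insert e ?\<tau> \<in> faces (Suc i)" using \<tau> finite_face[of ?\<tau>] by auto
    then show "(\<Sum>\<sigma>\<in>faces (Suc i). if \<sigma> = insert e ?\<tau> then sign \<sigma> e * on_faces (Suc i) c \<sigma> else 0) =
        sign (insert e ?\<tau>) e * on_faces (Suc i) c (insert e ?\<tau>)"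
      by simp
  qed
  finally show ?thesis .
qed

lemma on_faces_bd:
  assumes "\<tau> \<in> faces i"
  shows "on_faces i (bd (scalar_complex taylor) i c) \<tau> = (boundary (on_faces (Suc i) c) \<tau> :: 'k::field)"
  using assms bd_taylor[OF face_index_less[OF assms], of c] face_face_index[OF assms]
  by (simp add: on_faces_def)

lemma strand_eqI:
  assumes "c \<in> strand (scalar_complex taylor) i \<alpha>" "d \<in> strand (scalar_complex taylor) i \<alpha>"
    and "\<And>\<tau>. \<tau> \<in> faces i \<Longrightarrow> on_faces i c \<tau> = on_faces i d \<tau>"
  shows "c = (d :: nat \<Rightarrow> 'k::field)"
proof
  fix j
  show "c j = d j"
  proof (cases "j < card (faces i)")
    case True
    then show ?thesis
      using assms(3)[of "face i j"] face_in[OF True] face_index_face[OF True] by (simp add: on_faces_def)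
  next
    case False
    then have "\<not> j < rk (scalar_complex (taylor :: ('v, 'k) free_complex)) i"
      by (simp add: level_rank_taylor)
    then have "c j = 0" "d j = 0"
      using strandD[OF assms(1), of j] strandD[OF assms(2), of j] by blast+
    then show ?thesis by simp
  qed
qed

lemma strand_taylor_iff:
  "c \<in> strand (scalar_complex taylor) i \<alpha> \<longleftrightarrow>
     (\<forall>j. c j \<noteq> 0 \<longrightarrow> j < card (faces i) \<and> lookup (indicator_degree (\<Union>(face i j))) \<le> \<alpha>)"
  by (auto simp: strand_def level_rank_taylor level_shift_taylor simp del: level_simps)

text \<open>
  A strand in degree \<open>\<alpha>\<close> sees the simplex on the edges whose monomials divide the monomial of
  degree \<open>\<alpha>\<close>.  It is contracted to any such edge.
\<close>

lemma taylor_exact: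
  assumes E: "E \<subseteq> Pow V"
  fixes C :: "('v \<Rightarrow> nat, 'k::field) graded_complex"
  defines "C \<equiv> scalar_complex taylor"
  shows "{c \<in> strand C (Suc i) \<alpha>. bd C i c = 0} = bd C (Suc i) ` strand C (Suc (Suc i)) \<alpha>"
proof (intro equalityI subsetI)
  have hom: "homogeneous_map C (Suc n) C n (df C n)" for n
    unfolding C_def by (rule homogeneous_entries_scalar[OF homogeneous_entries_taylor[OF E]])
  {
    fix c assume "c \<in> {c \<in> strand C (Suc i) \<alpha>. bd C i c = 0}"
    then have c: "c \<in> strand C (Suc i) \<alpha>" "bd C i c = 0" by auto
    show "c \<in> bd C (Suc i) ` strand C (Suc (Suc i)) \<alpha>"
    proof (cases "c = 0")
      case True
      then show ?thesis by (intro image_eqI[of _ _ 0]) auto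
    next
      case False
      then obtain j0 where "c j0 \<noteq> 0" by (auto simp: fun_eq_iff)
      then have j0: "j0 < card (faces (Suc i))"
          "lookup (indicator_degree (\<Union>(face (Suc i) j0))) \<le> \<alpha>"
        using c(1) unfolding C_def strand_taylor_iff by auto
      then obtain a where a: "a \<in> face (Suc i) j0" "a \<in> E"
        using face_in[OF j0(1)] by (metis card.empty ex_in_conv nat.simps(3) subsetD)
      have a_le: "lookup (indicator_degree a) \<le> \<alpha>"
        using indicator_degree_mono[of a "\<Union>(face (Suc i) j0)"] a(1) face_in[OF j0(1)]
          finite_Union_face j0(2) by (meson Sup_upper order_trans)
      let ?c = "on_faces (Suc i) c"
      define d where "d = (\<lambda>j. if j < card (faces (Suc (Suc i)))
        then cone a ?c (face (Suc (Suc i)) j) else 0)"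
      have on_d: "on_faces (Suc (Suc i)) d \<sigma> = cone a ?c \<sigma>" if "\<sigma> \<in> faces (Suc (Suc i))" for \<sigma>
        using that face_index_less[OF that] face_face_index[OF that] by (simp add: on_faces_def d_def)
      have d: "d \<in> strand C (Suc (Suc i)) \<alpha>"
        unfolding C_def strand_taylor_iff
      proof (intro allI impI)
        fix j assume "d j \<noteq> 0"
        then have j: "j < card (faces (Suc (Suc i)))" and "cone a ?c (face (Suc (Suc i)) j) \<noteq> 0"
          by (auto simp: d_def split: if_splits)
        then have a_in: "a \<in> face (Suc (Suc i)) j" and nz: "?c (face (Suc (Suc i)) j - {a}) \<noteq> 0"
          by (auto simp: cone_def split: if_splits)
        let ?\<rho> = "face (Suc (Suc i)) j - {a}"
        have \<rho>: "?\<rho> \<in> faces (Suc i)" "c (face_index (Suc i) ?\<rho>) \<noteq> 0"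
          using nz by (auto simp: on_faces_def split: if_splits)
        then have \<rho>_le: "lookup (indicator_degree (\<Union>?\<rho>)) \<le> \<alpha>"
          using c(1) face_face_index[OF \<rho>(1)] unfolding C_def strand_taylor_iff by metis
        have "\<Union>(face (Suc (Suc i)) j) = a \<union> \<Union>?\<rho>" using a_in by blast
        then have "lookup (indicator_degree (\<Union>(face (Suc (Suc i)) j))) v \<le> \<alpha> v" for v
          using le_funD[OF \<rho>_le, of v] le_funD[OF a_le, of v] face_in[OF j] \<rho>(1)
            finite_Union_face finite_edge[OF a(2)]
          by (auto simp: lookup_indicator_degree split: if_splits)
        then show "j < card (faces (Suc (Suc i))) \<and>
            lookup (indicator_degree (\<Union>(face (Suc (Suc i)) j))) \<le> \<alpha>"
          using j by (simp add: le_fun_def)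
      qed
      have "bd C (Suc i) d = c"
      proof (rule strand_eqI[where 'k = 'k and i = "Suc i" and \<alpha> = \<alpha>, folded C_def])
        show "bd C (Suc i) d \<in> strand C (Suc i) \<alpha>" by (rule lin_in_strand[OF hom d])
        show "c \<in> strand C (Suc i) \<alpha>" by (rule c(1))
        fix \<tau> assume \<tau>: "\<tau> \<in> faces (Suc i)"
        have "on_faces (Suc i) (bd C (Suc i) d) \<tau> = boundary (on_faces (Suc (Suc i)) d) \<tau>"
          unfolding C_def by (rule on_faces_bd[OF \<tau>])
        also have "\<dots> = boundary (cone a ?c) \<tau>"
          unfolding boundary_def
        proof (rule sum.cong[OF refl])
          fix e assume "e \<in> E - \<tau>"
          then have "insert e \<tau> \<in> faces (Suc (Suc i))" using \<tau> finite_face[of \<tau>] by auto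
          from on_d[OF this]
          show "sign (insert e \<tau>) e * on_faces (Suc (Suc i)) d (insert e \<tau>) =
              sign (insert e \<tau>) e * cone a ?c (insert e \<tau>)" by simp
        qed
        also have "\<dots> = ?c \<tau>"
        proof -
          have "boundary ?c (\<tau> - {a}) = 0" if "a \<in> \<tau>"
          proof -
            have "\<tau> - {a} \<in> faces i" using \<tau> that finite_face[of \<tau>] by auto
            from on_faces_bd[OF this, of c] show ?thesis
              using c(2) by (simp add: C_def on_faces_def split: if_splits)
          qed
          then have "cone a (boundary ?c) \<tau> = 0" by (simp add: cone_def)
          then show ?thesis using cone_homotopy[of \<tau> a ?c] \<tau> a(2) by simp
        qed
        finally show "on_faces (Suc i) (bd C (Suc i) d) \<tau> = ?c \<tau>" .
      qed
      then show ?thesis using d by blast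
    qed
  }
  fix c assume "c \<in> bd C (Suc i) ` strand C (Suc (Suc i)) \<alpha>"
  then obtain d where d: "d \<in> strand C (Suc (Suc i)) \<alpha>" "c = bd C (Suc i) d" by auto
  have c: "c \<in> strand C (Suc i) \<alpha>" unfolding d(2) by (rule lin_in_strand[OF hom d(1)])
  have "bd C i c = 0"
  proof (rule strand_eqI[where 'k = 'k and i = i and \<alpha> = \<alpha>, folded C_def])
    show "bd C i c \<in> strand C i \<alpha>" by (rule lin_in_strand[OF hom c])
    fix \<tau> assume \<tau>: "\<tau> \<in> faces i"
    have "on_faces i (bd C i c) \<tau> = boundary (on_faces (Suc i) c) \<tau>"
      unfolding C_def by (rule on_faces_bd[OF \<tau>])
    also have "\<dots> = boundary (boundary (on_faces (Suc (Suc i)) d)) \<tau>"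
      unfolding boundary_def[of "on_faces (Suc i) c"] boundary_def[of "boundary _"]
    proof (rule sum.cong[OF refl])
      fix e assume "e \<in> E - \<tau>"
      then have "insert e \<tau> \<in> faces (Suc i)" using \<tau> finite_face[of \<tau>] by auto
      from on_faces_bd[OF this, of d]
      show "sign (insert e \<tau>) e * on_faces (Suc i) c (insert e \<tau>) =
          sign (insert e \<tau>) e * boundary (on_faces (Suc (Suc i)) d) (insert e \<tau>)"
        by (simp add: d(2) C_def del: level_simps)
    qed
    also have "\<dots> = 0" using \<tau> by (intro boundary_boundary) auto
    finally show "on_faces i (bd C i c) \<tau> = on_faces i 0 \<tau>" by (simp add: on_faces_def)
  qed simp
  then show "c \<in> {c \<in> strand C (Suc i) \<alpha>. bd C i c = 0}" using c by simp
qed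

text \<open>
  The basis of the free module in homological degree \<open>0\<close> consists of the singletons \<open>{e}\<close>, and the
  augmentation sends \<open>{e}\<close> to the generator of the ideal that belongs to \<open>e\<close>.
\<close>

lemma aug_taylor:
  assumes E: "E \<subseteq> Pow V"
  shows "aug_map taylor ` fc_module V taylor 0 = (edge_ideal V E :: ('v, 'k::field) mpoly set)"
proof -
  define T :: "('v, 'k) free_complex" where "T = taylor"
  define n where "n = card (faces (Suc 0))"
  define b where "b = (\<lambda>j. the_elem (face (Suc 0) j))"
  have b: "bij_betw b {..<n} E"
  proof -
    have faces_1: "faces (Suc 0) = (\<lambda>e. {e}) ` E"
      by (auto simp: card_1_singleton_iff)
    have "bij_betw the_elem (faces (Suc 0)) E"
      unfolding faces_1 by (simp add: bij_betw_def inj_on_def image_image)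
    from bij_betw_trans[OF bij_face[of "Suc 0"] this] show ?thesis
      by (simp add: b_def n_def comp_def)
  qed
  have face: "face (Suc 0) j = {b j}" if "j < n" for j
    using face_in[of j "Suc 0"] that by (auto simp: b_def n_def card_Suc_eq)
  have aug: "aug_map T f = (\<Sum>j<n. f j * (\<Prod>v\<in>b j. var v))" for f
  proof -
    have "fc_aug T j = (\<Prod>v\<in>b j. var v)" if "j < n" for j
      using that face[OF that] b finite_edge by (simp add: T_def prod_var bij_betw_apply)
    then show ?thesis by (simp add: aug_map_def T_def n_def)
  qed
  show ?thesis
  proof (intro equalityI subsetI)
    fix p assume "p \<in> aug_map taylor ` (fc_module V taylor 0 :: (nat \<Rightarrow> ('v, 'k) mpoly) set)"
    then obtain f where f: "f \<in> fc_module V T 0" "p = aug_map T f" by (auto simp: T_def)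
    let ?q = "\<lambda>e. f (inv_into {..<n} b e)"
    have "p = (\<Sum>j<n. ?q (b j) * (\<Prod>v\<in>b j. var v))"
      unfolding f(2) aug
      by (intro sum.cong) (simp_all add: bij_betw_inv_into_left[OF b])
    also have "\<dots> = (\<Sum>e\<in>E. ?q e * (\<Prod>v\<in>e. var v))"
      by (rule sum.reindex_bij_betw[OF b])
    finally show "p \<in> edge_ideal V E"
      using f(1) by (auto simp: edge_ideal_def fc_module_def)
  next
    fix p :: "('v, 'k) mpoly" assume "p \<in> edge_ideal V E"
    then obtain q where q: "p = (\<Sum>e\<in>E. q e * (\<Prod>v\<in>e. var v))" "\<forall>e\<in>E. q e \<in> polynomials V"
      by (auto simp: edge_ideal_def)
    let ?f = "\<lambda>j. if j < n then q (b j) else 0"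
    have "p = (\<Sum>j<n. q (b j) * (\<Prod>v\<in>b j. var v))"
      unfolding q(1) by (rule sum.reindex_bij_betw[OF b, symmetric])
    then have "p = aug_map T ?f" by (simp add: aug)
    moreover have "?f \<in> fc_module V T 0"
      using q(2) b by (auto simp: fc_module_def T_def n_def bij_betw_apply)
    ultimately show "p \<in> aug_map taylor ` fc_module V taylor 0" unfolding T_def by blast
  qed
qed

theorem taylor_resolution:
  assumes "E \<subseteq> Pow V"
  shows "graded_free_resolution V (edge_ideal V E :: ('v, 'k::field) mpoly set) taylor"
  by (rule resolution_of_scalar_exactness[OF homogeneous_entries_taylor[OF assms]
      aug_taylor[OF assms] taylor_exact[OF assms]])

subsection \<open>Betti numbers\<close>

lemma tor_chains_taylor:
  "tor_chains taylor i \<alpha> = {c :: nat \<Rightarrow> 'k::field. \<forall>j. c j \<noteq> 0 \<longrightarrow>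
     j \<in> {j. j < card (faces (Suc i)) \<and> indicator_degree (\<Union>(face (Suc i) j)) = \<alpha>}}"
  by (simp add: tor_chains_def)

lemma dim_tor_chains_taylor:
  "vec_dim (tor_chains taylor i \<alpha> :: (nat \<Rightarrow> 'k::field) set) =
     card {\<sigma>. \<sigma> \<subseteq> E \<and> card \<sigma> = Suc i \<and> indicator_degree (\<Union>\<sigma>) = \<alpha>}"
proof -
  let ?S = "{j. j < card (faces (Suc i)) \<and> indicator_degree (\<Union>(face (Suc i) j)) = \<alpha>}"
  have inj: "inj_on (face (Suc i)) ?S"
    by (rule inj_on_subset[OF bij_betw_imp_inj_on[OF bij_face]]) auto
  have image: "face (Suc i) ` ?S = {\<sigma>. \<sigma> \<subseteq> E \<and> card \<sigma> = Suc i \<and> indicator_degree (\<Union>\<sigma>) = \<alpha>}"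
  proof (intro equalityI subsetI)
    fix \<sigma> assume \<sigma>: "\<sigma> \<in> {\<sigma>. \<sigma> \<subseteq> E \<and> card \<sigma> = Suc i \<and> indicator_degree (\<Union>\<sigma>) = \<alpha>}"
    then have "\<sigma> \<in> faces (Suc i)" by blast
    from face_index_less[OF this] face_face_index[OF this] \<sigma>
    show "\<sigma> \<in> face (Suc i) ` ?S" by (intro image_eqI[of _ _ "face_index (Suc i) \<sigma>"]) auto
  next
    fix \<sigma> assume "\<sigma> \<in> face (Suc i) ` ?S"
    then obtain j where "j < card (faces (Suc i))" "indicator_degree (\<Union>(face (Suc i) j)) = \<alpha>"
      "\<sigma> = face (Suc i) j" by blast
    then show "\<sigma> \<in> {\<sigma>. \<sigma> \<subseteq> E \<and> card \<sigma> = Suc i \<and> indicator_degree (\<Union>\<sigma>) = \<alpha>}"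
      using face_in[of j "Suc i"] by simp
  qed
  show ?thesis
    unfolding vec_dim_eq tor_chains_taylor image[symmetric] card_image[OF inj]
    by (rule dim_supported) simp
qed

lemma tor_chains_taylor_in_span:
  "\<exists>T. finite T \<and> tor_chains taylor i \<alpha> \<subseteq> coords.span (T :: (nat \<Rightarrow> 'k::field) set)"
  unfolding tor_chains_taylor by (rule exI, rule conjI[OF _ supported_in_span]) auto

lemma betti_le_taylor:
  assumes E: "E \<subseteq> Pow V"
  shows "betti V (edge_ideal V E :: ('v, 'k::field) mpoly set) i \<alpha> \<le>
    card {\<sigma>. \<sigma> \<subseteq> E \<and> card \<sigma> = Suc i \<and> indicator_degree (\<Union>\<sigma>) = \<alpha>}"
proof -
  obtain T :: "(nat \<Rightarrow> 'k) set" where T: "finite T" "tor_chains taylor i \<alpha> \<subseteq> coords.span T"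
    using tor_chains_taylor_in_span by blast
  obtain B :: "(nat \<Rightarrow> 'k) set" where B: "B \<subseteq> tor_cycles taylor i \<alpha>" "coords.independent B"
      "card B = vec_dim (tor_cycles taylor i \<alpha> :: (nat \<Rightarrow> 'k) set)"
    using coords.basis_exists[of "tor_cycles taylor i \<alpha>"] unfolding vec_dim_eq by metis
  have "tor_cycles taylor i \<alpha> \<subseteq> (tor_chains taylor i \<alpha> :: (nat \<Rightarrow> 'k) set)"
    by (auto simp: tor_cycles_def)
  then have "card B \<le> vec_dim (tor_chains taylor i \<alpha> :: (nat \<Rightarrow> 'k) set)"
    unfolding vec_dim_eq using B(1) by (intro coords.card_independent_le_dim[OF T B(2)]) blast
  then show ?thesis
    using B(3) unfolding betti_eq[OF taylor_resolution[OF E]] dim_tor_chains_taylor by simp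
qed

text \<open>
  If every edge has a vertex that lies on no other edge, then removing an edge from a face lowers its
  degree, so no entry of the Taylor complex has a constant coefficient.
\<close>

lemma betti_eq_taylor:
  assumes E: "E \<subseteq> Pow V" and own_vertex: "\<And>e. e \<in> E \<Longrightarrow> \<not> e \<subseteq> \<Union>(E - {e})"
  shows "betti V (edge_ideal V E :: ('v, 'k::field) mpoly set) i \<alpha> =
    card {\<sigma>. \<sigma> \<subseteq> E \<and> card \<sigma> = Suc i \<and> indicator_degree (\<Union>\<sigma>) = \<alpha>}"
proof -
  let ?T = "taylor :: ('v, 'k) free_complex"
  have const: "lookup (fc_diff ?T n j l) 0 = 0"
    if jl: "j < card (faces (Suc (Suc n)))" "l < card (faces (Suc n))" for n j l
  proof (rule ccontr)
    let ?\<sigma> = "face (Suc (Suc n)) j" and ?\<tau> = "face (Suc n) l"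
    assume "lookup (fc_diff ?T n j l) 0 \<noteq> 0"
    then have diff: "indicator_degree (\<Union>?\<sigma>) - indicator_degree (\<Union>?\<tau>) = 0"
      and nz: "(incidence ?\<sigma> ?\<tau> :: 'k) \<noteq> 0"
      by (auto simp: lookup_single when_def split: if_splits)
    from incidence_nonzeroD[OF nz] obtain e where e: "e \<in> E" "e \<notin> ?\<tau>" "?\<sigma> = insert e ?\<tau>"
      by blast
    obtain v where v: "v \<in> e" "v \<notin> \<Union>(E - {e})" using own_vertex[OF e(1)] by blast
    then have "v \<in> \<Union>?\<sigma>" "v \<notin> \<Union>?\<tau>" using e face_in[OF jl(2)] by auto
    then have "lookup (indicator_degree (\<Union>?\<sigma>) - indicator_degree (\<Union>?\<tau>)) v = 1"
      using face_in[OF jl(1)] face_in[OF jl(2)]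
      by (simp add: lookup_minus lookup_indicator_degree finite_Union_face)
    then show False using diff by simp
  qed
  have tor_map: "tor_map ?T n c = 0" for n c
    using const by (auto simp: tor_map_def fun_eq_iff simp del: taylor_simps(4) intro!: sum.neutral)
  then have "tor_cycles ?T i \<alpha> = tor_chains ?T i \<alpha>"
    by (cases i) (auto simp: tor_cycles_def)
  moreover have "tor_boundaries ?T i \<alpha> = {0}"
    unfolding tor_boundaries_def tor_map by (auto simp: tor_chains_def)
  moreover have "coords.dim {0 :: nat \<Rightarrow> 'k} = 0"
    by (rule coords.dim_unique[OF _ _ coords.independent_empty]) auto
  ultimately show ?thesis
    using betti_eq[OF taylor_resolution[OF E, where 'k = 'k]] dim_tor_chains_taylor[where 'k = 'k]
    by (simp add: vec_dim_eq)
qed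

text \<open>
  If \<open>e\<close> is covered by the other edges, then \<open>E\<close> and \<open>E - {e}\<close> have the same degree, so the basis
  element \<open>E\<close> is a chain in degree \<open>\<Union>E\<close> that is not a cycle.
\<close>

lemma betti_less_taylor:
  assumes E: "E \<subseteq> Pow V" and e: "e \<in> E" "e \<noteq> {}" "e \<subseteq> \<Union>(E - {e})"
  shows "betti V (edge_ideal V E :: ('v, 'k::field) mpoly set) (card E - 1) (indicator_degree (\<Union>E)) <
    card {\<sigma>. \<sigma> \<subseteq> E \<and> card \<sigma> = Suc (card E - 1) \<and> indicator_degree (\<Union>\<sigma>) = indicator_degree (\<Union>E)}"
proof -
  let ?T = "taylor :: ('v, 'k) free_complex" and ?\<alpha> = "indicator_degree (\<Union>E)"
  have "E - {e} \<noteq> {}" using e(2,3) by auto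
  then have "card (E - {e}) > 0" using finite_E by (simp add: card_gt_0_iff)
  then obtain h where h: "card (E - {e}) = Suc h" using gr0_implies_Suc by blast
  then have cE: "card E = Suc (Suc h)"
    using card_Suc_Diff1[OF finite_E e(1)] by simp
  have mem: "E \<in> faces (Suc (Suc h))" "E - {e} \<in> faces (Suc h)" using cE h by auto
  define j l where "j = face_index (Suc (Suc h)) E" and "l = face_index (Suc h) (E - {e})"
  have j: "j < card (faces (Suc (Suc h)))" "face (Suc (Suc h)) j = E"
    and l: "l < card (faces (Suc h))" "face (Suc h) l = E - {e}"
    unfolding j_def l_def
    using face_index_less[OF mem(1)] face_face_index[OF mem(1)]
      face_index_less[OF mem(2)] face_face_index[OF mem(2)] by auto
  have U: "\<Union>(E - {e}) = \<Union>E" using e(1,3) by blast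
  have "lookup (fc_diff ?T h j l) 0 = incidence E (E - {e})"
    by (simp add: j l U)
  also have "\<dots> \<noteq> (0 :: 'k)"
    using incidence_insert[of e "E - {e}", where 'k = 'k] e(1) sign_nonzero[of E e, where 'k = 'k]
    by (simp add: insert_absorb)
  finally have "tor_map ?T h (unit_vec j) l \<noteq> 0"
    using j(1) l(1) by (simp add: tor_map_def unit_vec_def if_distribR if_distrib cong: if_cong)
  then have "unit_vec j \<notin> tor_cycles ?T (Suc h) ?\<alpha>"
    by (auto simp: tor_cycles_def fun_eq_iff)
  moreover have "unit_vec j \<in> tor_chains ?T (Suc h) ?\<alpha>"
    using j by (simp add: tor_chains_def unit_vec_def)
  moreover have "coords.subspace (tor_cycles ?T (Suc h) ?\<alpha>)"
    unfolding tor_cycles_eq[OF homogeneous_entries_taylor[OF E]] by (rule subspace_residue_cycles)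
  moreover have "tor_cycles ?T (Suc h) ?\<alpha> \<subseteq> tor_chains ?T (Suc h) ?\<alpha>"
    by (auto simp: tor_cycles_def)
  moreover obtain T :: "(nat \<Rightarrow> 'k) set" where
      "finite T" "tor_chains ?T (Suc h) ?\<alpha> \<subseteq> coords.span T"
    using tor_chains_taylor_in_span by blast
  ultimately have "vec_dim (tor_cycles ?T (Suc h) ?\<alpha>) < vec_dim (tor_chains ?T (Suc h) ?\<alpha>)"
    unfolding vec_dim_eq by (intro coords.dim_less_proper_subspace)
  then show ?thesis
    unfolding betti_eq[OF taylor_resolution[OF E]] dim_tor_chains_taylor using cE by simp
qed

end

lemma enumerated_simplex_exists:
  assumes "finite E" "\<And>e. e \<in> E \<Longrightarrow> finite e"
  obtains pos face where "enumerated_simplex E pos face"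
proof -
  obtain pos :: "'a set \<Rightarrow> nat" where pos: "inj_on pos E"
    using finite_imp_inj_to_nat_seg[OF assms(1)] by blast
  have "\<exists>f. bij_betw f {..<card {\<sigma>. \<sigma> \<subseteq> E \<and> card \<sigma> = i}} {\<sigma>. \<sigma> \<subseteq> E \<and> card \<sigma> = i}" for i
    using ex_bij_betw_nat_finite[of "{\<sigma>. \<sigma> \<subseteq> E \<and> card \<sigma> = i}"] assms(1)
    by (simp add: atLeast0LessThan)
  then have "\<forall>i. \<exists>f. bij_betw f {..<card {\<sigma>. \<sigma> \<subseteq> E \<and> card \<sigma> = i}} {\<sigma>. \<sigma> \<subseteq> E \<and> card \<sigma> = i}"
    by blast
  from choice[OF this]
  obtain face where face: "\<And>i. bij_betw (face i) {..<card {\<sigma>. \<sigma> \<subseteq> E \<and> card \<sigma> = i}} {\<sigma>. \<sigma> \<subseteq> E \<and> card \<sigma> = i}"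
    by blast
  show ?thesis
    by (rule that[OF enumerated_simplex.intro[OF assms pos face]])
qed

lemma Union_degree_set:
  assumes "finite V" "E \<subseteq> Pow V" "W \<subseteq> V"
  shows "{\<sigma>. \<sigma> \<subseteq> E \<and> card \<sigma> = Suc i \<and> indicator_degree (\<Union>\<sigma>) = indicator_degree W} =
    {\<sigma>. \<sigma> \<subseteq> E \<and> card \<sigma> = Suc i \<and> \<Union>\<sigma> = W}"
proof -
  have "indicator_degree (\<Union>\<sigma>) = indicator_degree W \<longleftrightarrow> \<Union>\<sigma> = W" if "\<sigma> \<subseteq> E" for \<sigma>
  proof (rule indicator_degree_eq_iff)
    show "finite (\<Union>\<sigma>)" using finite_subset[OF _ assms(1)] assms(2) that by (meson Pow_iff Sup_least subset_iff)
    show "finite W" using finite_subset assms(1,3) by blast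
  qed
  then show ?thesis by blast
qed

lemma enumerated_simplex_of_subsets:
  assumes "finite V" "E \<subseteq> Pow V"
  obtains pos face where "enumerated_simplex E pos face"
proof -
  have "finite E" using assms by (meson finite_Pow_iff finite_subset)
  moreover have "finite e" if "e \<in> E" for e using that assms finite_subset by blast
  ultimately show ?thesis using enumerated_simplex_exists that by blast
qed

lemma betti_le_card:
  assumes V: "finite V" and E: "E \<subseteq> Pow V" and W: "W \<subseteq> V"
  shows "betti V (edge_ideal V E :: ('v, 'k::field) mpoly set) i (indicator_degree W) \<le>
    card {\<sigma>. \<sigma> \<subseteq> E \<and> card \<sigma> = Suc i \<and> \<Union>\<sigma> = W}"
proof -
  obtain pos face where "enumerated_simplex E pos face"
    using enumerated_simplex_of_subsets[OF V E] .
  from enumerated_simplex.betti_le_taylor[OF this E] show ?thesis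
    unfolding Union_degree_set[OF V E W, symmetric] .
qed

lemma betti_eq_card:
  assumes V: "finite V" and E: "E \<subseteq> Pow V" and W: "W \<subseteq> V"
    and own_vertex: "\<And>e. e \<in> E \<Longrightarrow> \<not> e \<subseteq> \<Union>(E - {e})"
  shows "betti V (edge_ideal V E :: ('v, 'k::field) mpoly set) i (indicator_degree W) =
    card {\<sigma>. \<sigma> \<subseteq> E \<and> card \<sigma> = Suc i \<and> \<Union>\<sigma> = W}"
proof -
  obtain pos face where "enumerated_simplex E pos face"
    using enumerated_simplex_of_subsets[OF V E] .
  from enumerated_simplex.betti_eq_taylor[OF this E own_vertex] show ?thesis
    unfolding Union_degree_set[OF V E W, symmetric] .
qed

lemma betti_less_card:
  assumes V: "finite V" and E: "E \<subseteq> Pow V" and e: "e \<in> E" "e \<noteq> {}" "e \<subseteq> \<Union>(E - {e})"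
  shows "betti V (edge_ideal V E :: ('v, 'k::field) mpoly set) (card E - 1) (indicator_degree (\<Union>E)) <
    card {\<sigma>. \<sigma> \<subseteq> E \<and> card \<sigma> = Suc (card E - 1) \<and> \<Union>\<sigma> = \<Union>E}"
proof -
  obtain pos face where simplex: "enumerated_simplex E pos face"
    using enumerated_simplex_of_subsets[OF V E] .
  have W: "\<Union>E \<subseteq> V" using E by auto
  show ?thesis
    using enumerated_simplex.betti_less_taylor[OF simplex E e, where 'k = 'k]
    unfolding Union_degree_set[OF V E W] .
qed

section \<open>Counting edge sets by their rows\<close>

definition row_edge_sets :: "('x + 'y) set set \<Rightarrow> nat \<Rightarrow> 'x set \<Rightarrow> ('x + 'y) set set set" where
  "row_edge_sets E i X' = {\<sigma>. \<sigma> \<subseteq> E \<and> card \<sigma> = Suc i \<and> Inl -` \<Union>\<sigma> = X'}"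

lemma Plus_eq_iff: "W = X' <+> Y' \<longleftrightarrow> Inl -` W = X' \<and> Inr -` W = Y'"
proof
  assume R: "Inl -` W = X' \<and> Inr -` W = Y'"
  have "v \<in> W \<longleftrightarrow> v \<in> X' <+> Y'" for v
    using R by (cases v) auto
  then show "W = X' <+> Y'" by blast
qed auto

lemma bipartite_edges:
  assumes "bipartite_graph X Y E"
  shows "finite (X <+> Y)" "E \<subseteq> Pow (X <+> Y)" "finite E"
proof -
  show fin: "finite (X <+> Y)" using assms by (simp add: bipartite_graph_def)
  show sub: "E \<subseteq> Pow (X <+> Y)" using assms by (auto simp: bipartite_graph_def)
  show "finite E" using fin sub by (meson finite_Pow_iff finite_subset)
qed

lemma bipartite_edgeE:
  assumes "bipartite_graph X Y E" "e \<in> E"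
  obtains x y where "x \<in> X" "y \<in> Y" "e = {Inl x, Inr y}"
  using assms unfolding bipartite_graph_def by blast

lemma card_row_edge_sets:
  assumes G: "bipartite_graph X Y E"
  shows "card (row_edge_sets E i X') =
    (\<Sum>Y'\<in>Pow Y. card {\<sigma>. \<sigma> \<subseteq> E \<and> card \<sigma> = Suc i \<and> \<Union>\<sigma> = X' <+> Y'})"
proof -
  have cols: "Inr -` \<Union>\<sigma> \<in> Pow Y" if "\<sigma> \<subseteq> E" for \<sigma>
    using that bipartite_edges(2)[OF G] by auto
  have "row_edge_sets E i X' = (\<Union>Y'\<in>Pow Y. {\<sigma>. \<sigma> \<subseteq> E \<and> card \<sigma> = Suc i \<and> \<Union>\<sigma> = X' <+> Y'})"
    unfolding row_edge_sets_def Plus_eq_iff using cols by blast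
  moreover have "card (\<Union>Y'\<in>Pow Y. {\<sigma>. \<sigma> \<subseteq> E \<and> card \<sigma> = Suc i \<and> \<Union>\<sigma> = X' <+> Y'}) =
      (\<Sum>Y'\<in>Pow Y. card {\<sigma>. \<sigma> \<subseteq> E \<and> card \<sigma> = Suc i \<and> \<Union>\<sigma> = X' <+> Y'})"
  proof (rule card_UN_disjoint)
    show "finite (Pow Y)" using G by (simp add: bipartite_graph_def)
    show "\<forall>Y'\<in>Pow Y. finite {\<sigma>. \<sigma> \<subseteq> E \<and> card \<sigma> = Suc i \<and> \<Union>\<sigma> = X' <+> Y'}"
      using bipartite_edges(3)[OF G] by simp
    show "\<forall>Y1\<in>Pow Y. \<forall>Y2\<in>Pow Y. Y1 \<noteq> Y2 \<longrightarrow>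
        {\<sigma>. \<sigma> \<subseteq> E \<and> card \<sigma> = Suc i \<and> \<Union>\<sigma> = X' <+> Y1} \<inter>
        {\<sigma>. \<sigma> \<subseteq> E \<and> card \<sigma> = Suc i \<and> \<Union>\<sigma> = X' <+> Y2} = {}"
      unfolding Plus_eq_iff by blast
  qed
  ultimately show ?thesis by simp
qed

text \<open>
  An edge set whose rows lie in \<open>X'\<close> is a set of edges at \<open>X'\<close>, and these edges are
  distributed disjointly over the vertices in \<open>X'\<close>.
\<close>

lemma sum_row_edge_sets:
  assumes G: "bipartite_graph X Y E" and X': "X' \<subseteq> X"
  shows "(\<Sum>A\<in>Pow X'. card (row_edge_sets E i A)) = (\<Sum>x\<in>X'. degree E (Inl x)) choose (i + 1)"
proof -
  have finX: "finite X'" using G X' finite_subset by (auto simp: bipartite_graph_def)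
  have finE: "finite E" by (rule bipartite_edges(3)[OF G])
  define D where "D = (\<Union>x\<in>X'. {e \<in> E. Inl x \<in> e})"
  have rows: "Inl -` \<Union>\<sigma> \<in> Pow X' \<longleftrightarrow> \<sigma> \<subseteq> D" if "\<sigma> \<subseteq> E" for \<sigma>
  proof -
    have "Inl -` e \<subseteq> X' \<longleftrightarrow> e \<in> D" if "e \<in> E" for e
      by (rule bipartite_edgeE[OF G that]) (use that in \<open>auto simp: D_def\<close>)
    then have "(\<forall>e\<in>\<sigma>. Inl -` e \<subseteq> X') \<longleftrightarrow> \<sigma> \<subseteq> D" using that by blast
    then show ?thesis by (simp add: vimage_Union UN_subset_iff)
  qed
  have "D \<subseteq> E" by (auto simp: D_def)
  have "(\<Sum>A\<in>Pow X'. card (row_edge_sets E i A)) = card (\<Union>A\<in>Pow X'. row_edge_sets E i A)"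
    by (rule card_UN_disjoint[symmetric]) (use finX finE in \<open>auto simp: row_edge_sets_def\<close>)
  also have "(\<Union>A\<in>Pow X'. row_edge_sets E i A) = {\<sigma>. \<sigma> \<subseteq> D \<and> card \<sigma> = Suc i}"
  proof (rule set_eqI)
    fix \<sigma>
    have "\<sigma> \<in> (\<Union>A\<in>Pow X'. row_edge_sets E i A) \<longleftrightarrow>
        \<sigma> \<subseteq> E \<and> card \<sigma> = Suc i \<and> Inl -` \<Union>\<sigma> \<in> Pow X'"
      by (simp add: row_edge_sets_def)
    also have "\<dots> \<longleftrightarrow> \<sigma> \<in> {\<sigma>. \<sigma> \<subseteq> D \<and> card \<sigma> = Suc i}"
      using rows[of \<sigma>] subset_trans[OF _ \<open>D \<subseteq> E\<close>, of \<sigma>] by simp argo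
    finally show "\<sigma> \<in> (\<Union>A\<in>Pow X'. row_edge_sets E i A) \<longleftrightarrow> \<sigma> \<in> {\<sigma>. \<sigma> \<subseteq> D \<and> card \<sigma> = Suc i}" .
  qed
  also have "card \<dots> = card D choose Suc i"
    using finite_subset[OF \<open>D \<subseteq> E\<close> finE] by (rule n_subsets)
  also have "card D = (\<Sum>x\<in>X'. degree E (Inl x))"
    unfolding D_def degree_def
  proof (rule card_UN_disjoint[OF finX])
    show "\<forall>x\<in>X'. finite {e \<in> E. Inl x \<in> e}" using finE by simp
    have "x = x'" if "e \<in> E" "Inl x \<in> e" "Inl x' \<in> e" for e x x'
      by (rule bipartite_edgeE[OF G that(1)]) (use that in auto)
    then show "\<forall>x\<in>X'. \<forall>x'\<in>X'. x \<noteq> x' \<longrightarrow> {e \<in> E. Inl x \<in> e} \<inter> {e \<in> E. Inl x' \<in> e} = {}"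
      by blast
  qed
  finally show ?thesis by simp
qed

text \<open>
  By \<open>sum_row_edge_sets\<close> the totals over the subsets of \<open>X'\<close> depend only on the degrees.  The totals
  determine the single counts, since all terms but the one for \<open>X'\<close> itself belong to smaller sets.
\<close>

lemma card_row_edge_sets_cong:
  fixes X :: "'x set" and G :: "('x + 'y) set set" and H :: "('x + 'z) set set"
  assumes G: "bipartite_graph X Y G" and H: "bipartite_graph X Y'' H"
    and deg: "\<forall>x\<in>X. degree H (Inl x) = degree G (Inl x)"
  shows "X' \<subseteq> X \<Longrightarrow> card (row_edge_sets G i X') = card (row_edge_sets H i X')"
proof (induction "card X'" arbitrary: X' rule: less_induct)
  case less
  have fin: "finite X'" using G less.prems finite_subset by (auto simp: bipartite_graph_def)
  have total: "(\<Sum>A\<in>Pow X'. card (row_edge_sets E i A)) =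
      card (row_edge_sets E i X') + (\<Sum>A\<in>Pow X' - {X'}. card (row_edge_sets E i A))"
    for E :: "('x + 'w) set set"
    using fin by (intro sum.remove) auto
  have "card (row_edge_sets G i A) = card (row_edge_sets H i A)" if "A \<in> Pow X' - {X'}" for A
    using that less fin by (intro less.hyps) (auto intro!: psubset_card_mono)
  then have "(\<Sum>A\<in>Pow X' - {X'}. card (row_edge_sets G i A)) =
      (\<Sum>A\<in>Pow X' - {X'}. card (row_edge_sets H i A))" by (rule sum.cong[OF refl])
  moreover have "(\<Sum>x\<in>X'. degree G (Inl x)) = (\<Sum>x\<in>X'. degree H (Inl x))"
    using deg less.prems by (intro sum.cong) auto
  ultimately show ?case
    using sum_row_edge_sets[OF G less.prems, of i] sum_row_edge_sets[OF H less.prems, of i]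
    by (simp add: total)
qed

text \<open>
  The cell \<open>(x, y)\<close> is alone in its row iff \<open>x\<close> lies on no other edge, and alone in its column iff
  \<open>y\<close> lies on no other edge.
\<close>

lemma horizontal_vertical_iff_own_vertex:
  assumes G: "bipartite_graph X Y E"
  shows "horizontal_vertical E \<longleftrightarrow> (\<forall>e\<in>E. \<not> e \<subseteq> \<Union>(E - {e}))"
proof -
  have edge: "\<not> {Inl x, Inr y} \<subseteq> \<Union>(E - {{Inl x, Inr y}}) \<longleftrightarrow> column E y = {x} \<or> row E x = {y}"
    if e: "{Inl x, Inr y} \<in> E" for x y
  proof -
    have "Inl x \<in> \<Union>(E - {{Inl x, Inr y}}) \<longleftrightarrow> row E x \<noteq> {y}"
    proof
      assume "Inl x \<in> \<Union>(E - {{Inl x, Inr y}})"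
      then obtain f where f: "f \<in> E" "f \<noteq> {Inl x, Inr y}" "Inl x \<in> f" by blast
      from bipartite_edgeE[OF G f(1)] obtain x' y' where "f = {Inl x', Inr y'}" by blast
      then have "y' \<in> row E x" "y' \<noteq> y" using f by (auto simp: row_def)
      then show "row E x \<noteq> {y}" by blast
    next
      assume "row E x \<noteq> {y}"
      moreover have "y \<in> row E x" using e by (simp add: row_def)
      ultimately obtain y' where "y' \<in> row E x" "y' \<noteq> y" by blast
      then have "{Inl x, Inr y'} \<in> E - {{Inl x, Inr y}}" by (auto simp: row_def doubleton_eq_iff)
      then show "Inl x \<in> \<Union>(E - {{Inl x, Inr y}})" by blast
    qed
    moreover have "Inr y \<in> \<Union>(E - {{Inl x, Inr y}}) \<longleftrightarrow> column E y \<noteq> {x}"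
    proof
      assume "Inr y \<in> \<Union>(E - {{Inl x, Inr y}})"
      then obtain f where f: "f \<in> E" "f \<noteq> {Inl x, Inr y}" "Inr y \<in> f" by blast
      from bipartite_edgeE[OF G f(1)] obtain x' y' where "f = {Inl x', Inr y'}" by blast
      then have "x' \<in> column E y" "x' \<noteq> x" using f by (auto simp: column_def)
      then show "column E y \<noteq> {x}" by blast
    next
      assume "column E y \<noteq> {x}"
      moreover have "x \<in> column E y" using e by (simp add: column_def)
      ultimately obtain x' where "x' \<in> column E y" "x' \<noteq> x" by blast
      then have "{Inl x', Inr y} \<in> E - {{Inl x, Inr y}}" by (auto simp: column_def doubleton_eq_iff)
      then show "Inr y \<in> \<Union>(E - {{Inl x, Inr y}})" by blast
    qed
    ultimately show ?thesis by blast
  qed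
  show ?thesis
  proof
    assume hv: "horizontal_vertical E"
    show "\<forall>e\<in>E. \<not> e \<subseteq> \<Union>(E - {e})"
    proof
      fix e assume e: "e \<in> E"
      from bipartite_edgeE[OF G e] obtain x y where xy: "e = {Inl x, Inr y}" by blast
      then have "(x, y) \<in> diagram E" using e by (simp add: diagram_def)
      then have "column E y = {x} \<or> row E x = {y}" using hv unfolding horizontal_vertical_def by blast
      then show "\<not> e \<subseteq> \<Union>(E - {e})" using edge e xy by blast
    qed
  next
    assume own: "\<forall>e\<in>E. \<not> e \<subseteq> \<Union>(E - {e})"
    show "horizontal_vertical E"
      unfolding horizontal_vertical_def
    proof clarify
      fix x y assume "(x, y) \<in> diagram E" and row: "row E x \<noteq> {y}"
      then have e: "{Inl x, Inr y} \<in> E" by (simp add: diagram_def)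
      show "column E y = {x}" using edge[OF e] bspec[OF own e] row by argo
    qed
  qed
qed

section \<open>Betti numbers graded by rows\<close>

lemma row_betti_le:
  assumes G: "bipartite_graph X Y E" and X': "X' \<subseteq> X"
  shows "row_betti TYPE('k::field) X Y E i X' \<le> card (row_edge_sets E i X')"
  unfolding row_betti_def card_row_edge_sets[OF G]
  by (intro sum_mono betti_le_card[OF bipartite_edges(1,2)[OF G]]) (use X' in auto)

lemma row_betti_eq:
  assumes G: "bipartite_graph X Y E" and X': "X' \<subseteq> X" and hv: "horizontal_vertical E"
  shows "row_betti TYPE('k::field) X Y E i X' = card (row_edge_sets E i X')"
proof -
  have own: "\<not> e \<subseteq> \<Union>(E - {e})" if "e \<in> E" for e
    using hv that horizontal_vertical_iff_own_vertex[OF G] by blast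
  show ?thesis
    unfolding row_betti_def card_row_edge_sets[OF G]
    by (intro sum.cong refl betti_eq_card[OF bipartite_edges(1,2)[OF G] _ own]) (use X' in auto)
qed

lemma row_betti_less:
  fixes X :: "'x set" and Y :: "'y set"
  assumes G: "bipartite_graph X Y E" and not_hv: "\<not> horizontal_vertical E"
  shows "Inl -` \<Union>E \<subseteq> X"
    and "row_betti TYPE('k::field) X Y E (card E - 1) (Inl -` \<Union>E) <
      card (row_edge_sets E (card E - 1) (Inl -` \<Union>E))"
proof -
  let ?X' = "Inl -` \<Union>E" and ?Y' = "Inr -` \<Union>E"
  show X': "?X' \<subseteq> X" using bipartite_edges(2)[OF G] by auto
  have Y': "?Y' \<in> Pow Y" using bipartite_edges(2)[OF G] by auto
  have W: "?X' <+> ?Y' = \<Union>E" using Plus_eq_iff by metis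
  obtain e where e: "e \<in> E" "e \<subseteq> \<Union>(E - {e})"
    using not_hv horizontal_vertical_iff_own_vertex[OF G] by blast
  have "e \<noteq> {}" using bipartite_edgeE[OF G e(1)] by blast
  show "row_betti TYPE('k) X Y E (card E - 1) ?X' < card (row_edge_sets E (card E - 1) ?X')"
    unfolding row_betti_def card_row_edge_sets[OF G]
  (* The strict inequality occurs in the degree of the union of all edges. *)
  proof (rule sum_strict_mono_ex1)
    show "finite (Pow Y)" using G by (simp add: bipartite_graph_def)
    show "\<forall>Z\<in>Pow Y. betti (X <+> Y) (edge_ideal (X <+> Y) E :: ('x + 'y, 'k) mpoly set) (card E - 1)
          (indicator_degree (?X' <+> Z))
        \<le> card {\<sigma>. \<sigma> \<subseteq> E \<and> card \<sigma> = Suc (card E - 1) \<and> \<Union>\<sigma> = ?X' <+> Z}"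
      using X' by (intro ballI betti_le_card[OF bipartite_edges(1,2)[OF G]]) auto
    show "\<exists>Z\<in>Pow Y. betti (X <+> Y) (edge_ideal (X <+> Y) E :: ('x + 'y, 'k) mpoly set) (card E - 1)
          (indicator_degree (?X' <+> Z))
        < card {\<sigma>. \<sigma> \<subseteq> E \<and> card \<sigma> = Suc (card E - 1) \<and> \<Union>\<sigma> = ?X' <+> Z}"
      using Y' betti_less_card[OF bipartite_edges(1,2)[OF G] e(1) \<open>e \<noteq> {}\<close> e(2)]
      by (intro bexI[of _ ?Y']) (simp_all only: W)
  qed
qed

theorem corollary4p15:
  fixes X :: "'x set" and Y :: "'y set" and Y'' :: "'z set"
    and G :: "('x + 'y) set set" and H :: "('x + 'z) set set"
  assumes "bipartite_graph X Y G"
    and "bipartite_graph X Y'' H"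
    and "horizontal H"
    and "\<forall>x\<in>X. degree H (Inl x) = degree G (Inl x)"
  shows "(\<forall>i. \<forall>X'\<subseteq>X. row_betti TYPE('k::field) X Y G i X' \<le> row_betti TYPE('k) X Y'' H i X') \<and>
    (\<forall>i. \<forall>X'\<subseteq>X. (\<Sum>A\<in>Pow X'. row_betti TYPE('k) X Y'' H i A)
        = (\<Sum>x\<in>X'. degree G (Inl x)) choose (i + 1)) \<and>
    ((\<forall>i. \<forall>X'\<subseteq>X. row_betti TYPE('k) X Y G i X' = row_betti TYPE('k) X Y'' H i X')
        \<longleftrightarrow> horizontal_vertical G)"
proof -
  have hv: "horizontal_vertical H"
    using assms(3) unfolding horizontal_def horizontal_vertical_def by blast
  have H_eq: "row_betti TYPE('k) X Y'' H i A = card (row_edge_sets G i A)" if "A \<subseteq> X" for i A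
    using row_betti_eq[OF assms(2) that hv] card_row_edge_sets_cong[OF assms(1,2,4) that] by simp
  have le: "row_betti TYPE('k) X Y G i X' \<le> row_betti TYPE('k) X Y'' H i X'" if "X' \<subseteq> X" for i X'
    using row_betti_le[OF assms(1) that, where 'k = 'k] H_eq[OF that] by simp
  have total: "(\<Sum>A\<in>Pow X'. row_betti TYPE('k) X Y'' H i A) = (\<Sum>x\<in>X'. degree G (Inl x)) choose (i + 1)"
    if X': "X' \<subseteq> X" for i X'
  proof -
    have "(\<Sum>A\<in>Pow X'. row_betti TYPE('k) X Y'' H i A) = (\<Sum>A\<in>Pow X'. card (row_edge_sets G i A))"
      using X' by (intro sum.cong refl H_eq) auto
    also have "\<dots> = (\<Sum>x\<in>X'. degree G (Inl x)) choose (i + 1)"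
      by (rule sum_row_edge_sets[OF assms(1) X'])
    finally show ?thesis .
  qed
  have "horizontal_vertical G"
    if eq: "\<forall>i. \<forall>X'\<subseteq>X. row_betti TYPE('k) X Y G i X' = row_betti TYPE('k) X Y'' H i X'"
  proof (rule ccontr)
    assume not_hv: "\<not> horizontal_vertical G"
    note rows = row_betti_less(1)[OF assms(1) not_hv]
    show False
      using eq rows row_betti_less(2)[OF assms(1) not_hv, where 'k = 'k] H_eq[OF rows] by auto
  qed
  moreover have "row_betti TYPE('k) X Y G i X' = row_betti TYPE('k) X Y'' H i X'"
    if "horizontal_vertical G" "X' \<subseteq> X" for i X'
    using row_betti_eq[OF assms(1) that(2,1)] H_eq[OF that(2)] by simp
  ultimately show ?thesis using le total by blast
qed

end
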